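(* If $S$ is an exact semiring and $\Gamma$ is a finite group then the group semiring $S\Gamma$ is exact.
   Context: A semiring is a set $S$ with a commutative associative addition and an associative (not necessarily commutative) multiplication distributing over addition from both sides, such that for every non-empty finite subset $L\subseteq S$ there are local identities $0_L,1_L\in S$ with $a+0_Lb=1_La=a$ and $a+b0_L=a1_L=a$ for all $a,b\in L$. (No global zero or identity is required.) For a semiring $S$ and a finite group $\Gamma$, the group semiring $S\Gamma$ is the set of all functions $\Gamma\to S$ with $(f+g)(\alpha)=f(\alpha)+g(\alpha)$ and $(fg)(\alpha)=\sum_{\beta\in\Gamma}f(\beta)\,g(\beta^{-1}\alpha)$ for all $f,g\colon\Gamma\to S$ and $\alpha\in\Gamma$; it is a semiring, in the sense that its addition is commutative and associative, its multiplication is associative and distributes over addition from both sides, and for every non-empty finite subset $L\subseteq S\Gamma$ there are local identities $0_L,1_L\in S\Gamma$ with $f+0_Lg=1_Lf=f$ and $f+g0_L=f1_L=f$ for all $f,g\in L$. $S^{m\times n}$ is the set of $m\times n$ matrices over $S$, with the usual matrix addition and multiplication. For $A\in S^{m\times n}$, $\operatorname{Row}(A)=\{uA: u\in S^{1\times m}\}\subseteq S^{1\times n}$ and $\operatorname{Col}(A)=\{Av: v\in S^{n\times 1}\}\subseteq S^{m\times 1}$. A semiring $S$ is exact if for all positive integers $m,n$ and all $A\in S^{m\times n}$: (E1) if $x\in S^{1\times n}\setminus\operatorname{Row}(A)$ then there are $v,v'\in S^{n\times 1}$ with $Av=Av'$ but $xv\neq xv'$; and (E2) if $y\in S^{m\times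 1}\setminus\operatorname{Col}(A)$ then there are $u,u'\in S^{1\times m}$ with $uA=u'A$ but $uy\neq u'y$. *)

theory Defs
  imports "HOL-Algebra.FiniteProduct" "Jordan_Normal_Form.Matrix"
begin

(* The algebra records of HOL-Algebra and the type classes of HOL with finite sums or matrix
   products all come with a global zero (or one); here neither exists, so the structure carries
   only an addition and a multiplication. *)

record 'a add_mult = "'a partial_object" +
  plus_op :: "'a \<Rightarrow> 'a \<Rightarrow> 'a" (infixl \<open>\<boxplus>\<index>\<close> 65)
  times_op :: "'a \<Rightarrow> 'a \<Rightarrow> 'a" (infixl \<open>\<boxtimes>\<index>\<close> 70)

locale local_semiring =
  fixes S :: "('a, 'm) add_mult_scheme" (structure)
  assumes plus_closed: "\<lbrakk>a \<in> carrier S; b \<in> carrier S\<rbrakk> \<Longrightarrow> a \<boxplus> b \<in> carrier S"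
    and plus_assoc: "\<lbrakk>a \<in> carrier S; b \<in> carrier S; c \<in> carrier S\<rbrakk>
      \<Longrightarrow> (a \<boxplus> b) \<boxplus> c = a \<boxplus> (b \<boxplus> c)"
    and plus_commute: "\<lbrakk>a \<in> carrier S; b \<in> carrier S\<rbrakk> \<Longrightarrow> a \<boxplus> b = b \<boxplus> a"
    and times_closed: "\<lbrakk>a \<in> carrier S; b \<in> carrier S\<rbrakk> \<Longrightarrow> a \<boxtimes> b \<in> carrier S"
    and times_assoc: "\<lbrakk>a \<in> carrier S; b \<in> carrier S; c \<in> carrier S\<rbrakk>
      \<Longrightarrow> (a \<boxtimes> b) \<boxtimes> c = a \<boxtimes> (b \<boxtimes> c)"
    and distrib_right: "\<lbrakk>a \<in> carrier S; b \<in> carrier S; c \<in> carrier S\<rbrakk>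
      \<Longrightarrow> (a \<boxplus> b) \<boxtimes> c = a \<boxtimes> c \<boxplus> b \<boxtimes> c"
    and distrib_left: "\<lbrakk>a \<in> carrier S; b \<in> carrier S; c \<in> carrier S\<rbrakk>
      \<Longrightarrow> a \<boxtimes> (b \<boxplus> c) = a \<boxtimes> b \<boxplus> a \<boxtimes> c"
    and local_identities: "\<lbrakk>L \<subseteq> carrier S; finite L; L \<noteq> {}\<rbrakk>
      \<Longrightarrow> \<exists>z\<in>carrier S. \<exists>e\<in>carrier S. \<forall>a\<in>L. \<forall>b\<in>L.
            a \<boxplus> z \<boxtimes> b = a \<and> e \<boxtimes> a = a \<and> a \<boxplus> b \<boxtimes> z = a \<and> a \<boxtimes> e = a"

(* Sum of a non-empty finite family. In the absence of a zero the fold starts from the summand at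
   an arbitrarily chosen index; by ssum_singleton and ssum_insert below the choice is irrelevant.
   The value is unspecified for empty or infinite A. *)

definition ssum :: "('a, 'm) add_mult_scheme \<Rightarrow> ('i \<Rightarrow> 'a) \<Rightarrow> 'i set \<Rightarrow> 'a" where
  "ssum S f A = (let i = (SOME i. i \<in> A)
     in foldD (carrier S) (\<lambda>j s. f j \<boxplus>\<^bsub>S\<^esub> s) (f i) (A - {i}))"

(* S^{m x n}, on the matrix type of Jordan_Normal_Form. The library's product needs a global zero,
   hence smat_mult. *)

definition smat :: "('a, 'm) add_mult_scheme \<Rightarrow> nat \<Rightarrow> nat \<Rightarrow> 'a mat set" where
  "smat S m n = {A \<in> carrier_mat m n. elements_mat A \<subseteq> carrier S}"

definition smat_mult :: "('a, 'm) add_mult_scheme \<Rightarrow> 'a mat \<Rightarrow> 'a mat \<Rightarrow> 'a mat" where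
  "smat_mult S A B = mat (dim_row A) (dim_col B)
     (\<lambda>(i, j). ssum S (\<lambda>k. A $$ (i, k) \<boxtimes>\<^bsub>S\<^esub> B $$ (k, j)) {..<dim_col A})"

definition Row :: "('a, 'm) add_mult_scheme \<Rightarrow> 'a mat \<Rightarrow> 'a mat set" where
  "Row S A = {smat_mult S u A |u. u \<in> smat S 1 (dim_row A)}"

definition Col :: "('a, 'm) add_mult_scheme \<Rightarrow> 'a mat \<Rightarrow> 'a mat set" where
  "Col S A = {smat_mult S A v |v. v \<in> smat S (dim_col A) 1}"

locale exact_semiring = local_semiring +
  assumes exact_row: "\<lbrakk>0 < m; 0 < n; A \<in> smat S m n; x \<in> smat S 1 n - Row S A\<rbrakk>
      \<Longrightarrow> \<exists>v\<in>smat S n 1. \<exists>v'\<in>smat S n 1.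
            smat_mult S A v = smat_mult S A v' \<and> smat_mult S x v \<noteq> smat_mult S x v'"
    and exact_col: "\<lbrakk>0 < m; 0 < n; A \<in> smat S m n; y \<in> smat S m 1 - Col S A\<rbrakk>
      \<Longrightarrow> \<exists>u\<in>smat S 1 m. \<exists>u'\<in>smat S 1 m.
            smat_mult S u A = smat_mult S u' A \<and> smat_mult S u y \<noteq> smat_mult S u' y"

(* Functions from the group to S are extensional, i.e. undefined outside carrier G, so that their
   equality is equality on the group. *)

definition group_semiring ::
  "('a, 'm) add_mult_scheme \<Rightarrow> ('g, 'k) monoid_scheme \<Rightarrow> ('g \<Rightarrow> 'a) add_mult" where
  "group_semiring S G =
    \<lparr>carrier = carrier G \<rightarrow>\<^sub>E carrier S,
     plus_op = (\<lambda>f g. \<lambda>\<alpha>\<in>carrier G. f \<alpha> \<boxplus>\<^bsub>S\<^esub> g \<alpha>),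
     times_op = (\<lambda>f g. \<lambda>\<alpha>\<in>carrier G.
       ssum S (\<lambda>\<beta>. f \<beta> \<boxtimes>\<^bsub>S\<^esub> g (inv\<^bsub>G\<^esub> \<beta> \<otimes>\<^bsub>G\<^esub> \<alpha>)) (carrier G))\<rparr>"

lemma ssum_singleton:
  assumes "f i \<in> carrier S"
  shows "ssum S f {i} = f i"
  using assms by (simp add: ssum_def foldD_empty)

context local_semiring
begin

lemma plus_left_commute:
  "\<lbrakk>a \<in> carrier S; b \<in> carrier S; c \<in> carrier S\<rbrakk> \<Longrightarrow> a \<boxplus> (b \<boxplus> c) = b \<boxplus> (a \<boxplus> c)"
  by (metis plus_assoc plus_commute)

lemma LCD_plus:
  assumes "f ` B \<subseteq> carrier S"
  shows "LCD B (carrier S) (\<lambda>j s. f j \<boxplus> s)"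
  using assms by unfold_locales (auto simp: image_subset_iff intro: plus_left_commute plus_closed)

lemma foldD_plus_swap:
  assumes "finite A" "f ` A \<subseteq> carrier S" "x \<in> carrier S" "y \<in> carrier S"
  shows "x \<boxplus> foldD (carrier S) (\<lambda>j s. f j \<boxplus> s) y A
       = y \<boxplus> foldD (carrier S) (\<lambda>j s. f j \<boxplus> s) x A"
  using assms(1,2)
proof (induction A)
  case empty
  then show ?case using assms by (simp add: foldD_empty plus_commute)
next
  case (insert i A)
  let ?F = "foldD (carrier S) (\<lambda>j s. f j \<boxplus> s)"
  interpret LCD "insert i A" "carrier S" "\<lambda>j s. f j \<boxplus> s"
    using insert by (intro LCD_plus) auto
  have ins: "?F e (insert i A) = f i \<boxplus> ?F e A" if "e \<in> carrier S" for e
    using insert that by (intro foldD_insert) auto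
  have cl: "?F e A \<in> carrier S" if "e \<in> carrier S" for e
    using insert that by (intro foldD_closed) auto
  have fi: "f i \<in> carrier S" using insert by auto
  have "x \<boxplus> ?F y (insert i A) = f i \<boxplus> (x \<boxplus> ?F y A)"
    using assms fi cl by (simp add: ins plus_left_commute)
  also have "\<dots> = f i \<boxplus> (y \<boxplus> ?F x A)"
    using insert by simp
  also have "\<dots> = y \<boxplus> ?F x (insert i A)"
    using assms fi cl by (simp add: ins plus_left_commute)
  finally show ?case .
qed

lemma ssum_eq_foldD:
  assumes "finite A" "f ` A \<subseteq> carrier S" "i \<in> A"
  shows "ssum S f A = foldD (carrier S) (\<lambda>j s. f j \<boxplus> s) (f i) (A - {i})"
proof -
  let ?F = "foldD (carrier S) (\<lambda>j s. f j \<boxplus> s)"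
  define k where "k = (SOME i. i \<in> A)"
  have k: "k \<in> A" unfolding k_def using assms(3) by (rule someI)
  have "?F (f k) (A - {k}) = ?F (f i) (A - {i})"
  proof (cases "k = i")
    case False
    define B where "B = A - {k, i}"
    have A: "A - {k} = insert i B" "A - {i} = insert k B"
      and B: "finite B" "i \<notin> B" "k \<notin> B" "B \<subseteq> A"
      using False k assms by (auto simp: B_def)
    interpret LCD A "carrier S" "\<lambda>j s. f j \<boxplus> s"
      using assms by (intro LCD_plus)
    have "?F (f k) (insert i B) = f i \<boxplus> ?F (f k) B"
      using B k assms by (intro foldD_insert) auto
    also have "\<dots> = f k \<boxplus> ?F (f i) B"
      using B k assms by (intro foldD_plus_swap) auto
    also have "\<dots> = ?F (f i) (insert k B)"
      using B k assms by (intro foldD_insert [symmetric]) auto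
    finally show ?thesis by (simp add: A)
  qed simp
  then show ?thesis by (simp add: ssum_def k_def [symmetric])
qed

lemma ssum_insert:
  assumes "finite A" "A \<noteq> {}" "i \<notin> A" "f ` insert i A \<subseteq> carrier S"
  shows "ssum S f (insert i A) = f i \<boxplus> ssum S f A"
proof -
  let ?F = "foldD (carrier S) (\<lambda>j s. f j \<boxplus> s)"
  obtain k where k: "k \<in> A" using assms by blast
  interpret LCD "insert i A" "carrier S" "\<lambda>j s. f j \<boxplus> s"
    using assms by (intro LCD_plus)
  have "ssum S f (insert i A) = ?F (f k) (insert i A - {k})"
    using assms k by (intro ssum_eq_foldD) auto
  also have "insert i A - {k} = insert i (A - {k})"
    using assms k by auto
  also have "?F (f k) \<dots> = f i \<boxplus> ?F (f k) (A - {k})"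
    using assms k by (intro foldD_insert) auto
  also have "?F (f k) (A - {k}) = ssum S f A"
    using assms k by (intro ssum_eq_foldD [symmetric]) auto
  finally show ?thesis .
qed

end

end

theory Submission
  imports Defs
begin

text \<open>
  A matrix \<open>A\<close> over \<open>S\<Gamma>\<close> with rows \<open>I\<close> and columns \<open>J\<close> expands to a matrix \<open>B\<close> over \<open>S\<close> with rows
  \<open>I \<times> \<Gamma>\<close> and columns \<open>J \<times> \<Gamma>\<close>, with entries
  \<open>B (i, \<beta>) (j, \<alpha>) = A\<^sub>i\<^sub>j (\<beta>\<inverse> \<alpha>)\<close>. Identifying a vector \<open>u\<close> over \<open>S\<Gamma>\<close> with the vector
  \<open>(i, \<beta>) \<mapsto> u\<^sub>i(\<beta>)\<close> over \<open>S\<close>, the convolution formula says that \<open>u A\<close> is identified with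
  \<open>u B\<close>. Hence a vector \<open>x\<close> outside the row span of \<open>A\<close> is, after identification, outside the row
  span of \<open>B\<close>, and exactness of \<open>S\<close> gives vectors \<open>v, v'\<close> over \<open>S\<close> with \<open>B v = B v'\<close> but
  \<open>x v \<noteq> x v'\<close>. Put \<open>V\<^sub>j(\<alpha>) = v(j, \<alpha>\<inverse>)\<close> and define \<open>V'\<close> from \<open>v'\<close> likewise. Substituting in the
  convolution, \<open>(A V)\<^sub>i(\<beta>) = (B v)(i, \<beta>\<inverse>)\<close>, so \<open>A V = A V'\<close>, while the value of \<open>x V\<close> at the
  identity of \<open>\<Gamma>\<close> is \<open>x v\<close>, so \<open>x V \<noteq> x V'\<close>. This is \<open>row_separated_T\<close>. For columns
  (\<open>col_separated_T\<close>) the same argument applies with \<open>B (i, \<beta>) (j, \<alpha>) = A\<^sub>i\<^sub>j (\<beta> \<alpha>\<inverse>)\<close>.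

  To allow \<open>I \<times> \<Gamma>\<close> as an index set, exactness is first carried over from matrices to families over
  arbitrary non-empty finite index sets. No zero of \<open>S\<close> is needed anywhere: all sums are
  non-empty, and local identities of \<open>S\<Gamma>\<close> for a finite set \<open>L\<close> arise from local identities
  \<open>z, e\<close> of \<open>S\<close> for the finite set of values of the members of \<open>L\<close>, as the constant function
  \<open>z\<close> and the function with value \<open>e\<close> at the identity of \<open>\<Gamma>\<close> and \<open>z\<close> elsewhere.
\<close>

section \<open>Finite sums without a zero\<close>

context local_semiring
begin

lemma ssum_closed:
  assumes "finite A" "A \<noteq> {}" "\<And>i. i \<in> A \<Longrightarrow> f i \<in> carrier S"
  shows "ssum S f A \<in> carrier S"
  using assms
proof (induction A rule: finite_ne_induct)
  case (insert i A)
  then have "ssum S f (insert i A) = f i \<boxplus> ssum S f A"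
    by (intro ssum_insert) auto
  then show ?case using insert by (simp add: plus_closed)
qed (simp add: ssum_singleton)

lemma ssum_insert':
  assumes "finite A" "A \<noteq> {}" "i \<notin> A" "f i \<in> carrier S" "\<And>k. k \<in> A \<Longrightarrow> f k \<in> carrier S"
  shows "ssum S f (insert i A) = f i \<boxplus> ssum S f A"
  using assms by (intro ssum_insert) auto

lemma ssum_cong:
  assumes "finite A" "A \<noteq> {}" "\<And>i. i \<in> A \<Longrightarrow> f i = g i" "\<And>i. i \<in> A \<Longrightarrow> g i \<in> carrier S"
  shows "ssum S f A = ssum S g A"
  using assms
  by (induction A rule: finite_ne_induct) (simp_all add: ssum_singleton ssum_insert')

lemma ssum_times_left:
  assumes "finite A" "A \<noteq> {}" "\<And>i. i \<in> A \<Longrightarrow> f i \<in> carrier S" "c \<in> carrier S"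
  shows "c \<boxtimes> ssum S f A = ssum S (\<lambda>i. c \<boxtimes> f i) A"
  using assms
  by (induction A rule: finite_ne_induct)
    (simp_all add: ssum_singleton ssum_insert' times_closed distrib_left ssum_closed)

lemma ssum_times_right:
  assumes "finite A" "A \<noteq> {}" "\<And>i. i \<in> A \<Longrightarrow> f i \<in> carrier S" "c \<in> carrier S"
  shows "ssum S f A \<boxtimes> c = ssum S (\<lambda>i. f i \<boxtimes> c) A"
  using assms
  by (induction A rule: finite_ne_induct)
    (simp_all add: ssum_singleton ssum_insert' times_closed distrib_right ssum_closed)

lemma plus_swap_middle:
  assumes "a \<in> carrier S" "b \<in> carrier S" "c \<in> carrier S" "d \<in> carrier S"
  shows "(a \<boxplus> b) \<boxplus> (c \<boxplus> d) = (a \<boxplus> c) \<boxplus> (b \<boxplus> d)"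
  using assms by (simp add: plus_assoc plus_closed plus_left_commute [of b c d])

lemma ssum_plus:
  assumes "finite A" "A \<noteq> {}" "\<And>i. i \<in> A \<Longrightarrow> f i \<in> carrier S" "\<And>i. i \<in> A \<Longrightarrow> g i \<in> carrier S"
  shows "ssum S (\<lambda>i. f i \<boxplus> g i) A = ssum S f A \<boxplus> ssum S g A"
  using assms
  by (induction A rule: finite_ne_induct)
    (simp_all add: ssum_singleton ssum_insert' plus_closed ssum_closed plus_swap_middle)

lemma ssum_swap:
  assumes "finite A" "A \<noteq> {}" "finite B" "B \<noteq> {}"
    and "\<And>i j. i \<in> A \<Longrightarrow> j \<in> B \<Longrightarrow> f i j \<in> carrier S"
  shows "ssum S (\<lambda>i. ssum S (f i) B) A = ssum S (\<lambda>j. ssum S (\<lambda>i. f i j) A) B"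
  using assms
proof (induction A rule: finite_ne_induct)
  case (singleton i)
  then have "ssum S (\<lambda>j. ssum S (\<lambda>i. f i j) {i}) B = ssum S (f i) B"
    by (intro ssum_cong) (simp_all add: ssum_singleton)
  then show ?case using singleton by (simp add: ssum_singleton ssum_closed)
next
  case (insert i A)
  have "ssum S (\<lambda>j. ssum S (\<lambda>i. f i j) (insert i A)) B
      = ssum S (\<lambda>j. f i j \<boxplus> ssum S (\<lambda>i. f i j) A) B"
    using insert by (intro ssum_cong) (simp_all add: ssum_insert' plus_closed ssum_closed)
  then show ?case using insert by (simp add: ssum_insert' ssum_plus ssum_closed)
qed

lemma ssum_reindex:
  assumes "finite A" "A \<noteq> {}" "inj_on h A" "\<And>i. i \<in> A \<Longrightarrow> f (h i) \<in> carrier S"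
  shows "ssum S f (h ` A) = ssum S (\<lambda>i. f (h i)) A"
  using assms
proof (induction A rule: finite_ne_induct)
  case (insert i A)
  have "ssum S f (insert (h i) (h ` A)) = f (h i) \<boxplus> ssum S f (h ` A)"
    using insert by (intro ssum_insert') auto
  then show ?case using insert by (simp add: ssum_insert')
qed (simp add: ssum_singleton)

lemma ssum_reindex_bij_betw:
  assumes "bij_betw h A B" "finite A" "A \<noteq> {}" "\<And>j. j \<in> B \<Longrightarrow> f j \<in> carrier S"
  shows "ssum S (\<lambda>i. f (h i)) A = ssum S f B"
  using ssum_reindex [of A h f] assms by (auto simp: bij_betw_def)

lemma ssum_Un_disjoint:
  assumes "finite A" "A \<noteq> {}" "finite B" "B \<noteq> {}" "A \<inter> B = {}"
    and "\<And>i. i \<in> A \<union> B \<Longrightarrow> f i \<in> carrier S"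
  shows "ssum S f (A \<union> B) = ssum S f A \<boxplus> ssum S f B"
  using assms
proof (induction A rule: finite_ne_induct)
  case (insert i A)
  have "ssum S f (insert i (A \<union> B)) = f i \<boxplus> ssum S f (A \<union> B)"
    using insert by (intro ssum_insert') auto
  then show ?case using insert by (simp add: ssum_insert' plus_assoc ssum_closed)
qed (simp add: ssum_singleton ssum_insert')

lemma ssum_Times:
  assumes "finite A" "A \<noteq> {}" "finite B" "B \<noteq> {}"
    and "\<And>i j. i \<in> A \<Longrightarrow> j \<in> B \<Longrightarrow> f (i, j) \<in> carrier S"
  shows "ssum S f (A \<times> B) = ssum S (\<lambda>i. ssum S (\<lambda>j. f (i, j)) B) A"
  using assms
proof (induction A rule: finite_ne_induct)
  case (singleton i)
  have "{i} \<times> B = Pair i ` B" by auto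
  then show ?case using singleton ssum_reindex [of B "Pair i" f]
    by (simp add: ssum_singleton ssum_closed inj_on_def)
next
  case (insert i A)
  have "insert i A \<times> B = Pair i ` B \<union> A \<times> B" by auto
  moreover have "ssum S f (Pair i ` B \<union> A \<times> B) = ssum S f (Pair i ` B) \<boxplus> ssum S f (A \<times> B)"
    using insert by (intro ssum_Un_disjoint) auto
  moreover have "ssum S f (Pair i ` B) = ssum S (\<lambda>j. f (i, j)) B"
    using insert by (intro ssum_reindex) (auto simp: inj_on_def)
  ultimately show ?case using insert by (simp add: ssum_insert' ssum_closed)
qed

text \<open>Terms that are absorbed by \<open>a\<close> take the place of zeros in the sums that compute products with
  local identities.\<close>

lemma ssum_absorb:
  assumes "finite A" "A \<noteq> {}" "\<And>i. i \<in> A \<Longrightarrow> t i \<in> carrier S" "a \<in> carrier S"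
    and "\<And>i. i \<in> A \<Longrightarrow> a \<boxplus> t i = a"
  shows "a \<boxplus> ssum S t A = a"
  using assms
proof (induction A rule: finite_ne_induct)
  case (insert i A)
  have "a \<boxplus> (t i \<boxplus> ssum S t A) = (a \<boxplus> t i) \<boxplus> ssum S t A"
    using insert by (simp add: plus_assoc [symmetric] ssum_closed)
  then show ?case using insert by (simp add: ssum_insert')
qed (simp add: ssum_singleton)

lemma ssum_eq_dominant:
  assumes "finite A" "k \<in> A" "\<And>i. i \<in> A \<Longrightarrow> t i \<in> carrier S"
    and "\<And>i. i \<in> A \<Longrightarrow> i \<noteq> k \<Longrightarrow> t k \<boxplus> t i = t k"
  shows "ssum S t A = t k"
proof (cases "A = {k}")
  case True
  then show ?thesis using assms by (simp add: ssum_singleton)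
next
  case False
  then have "ssum S t (insert k (A - {k})) = t k \<boxplus> ssum S t (A - {k})"
    using assms by (intro ssum_insert') auto
  also have "\<dots> = t k"
    using False assms by (intro ssum_absorb) auto
  finally show ?thesis using assms by (simp add: insert_absorb)
qed

end

section \<open>Exactness for families over arbitrary finite index sets\<close>

text \<open>A matrix is given as a family \<open>A i j\<close> with \<open>i \<in> I\<close> and \<open>j \<in> J\<close>, so that pairs of a natural
  number and a group element can serve as indices. The vector \<open>x\<close> is in the row span of \<open>A\<close> if
  \<open>u A = x\<close> for some \<open>u\<close>; values outside the index sets play no role.\<close>

definition in_row_span ::
  "('a, 'm) add_mult_scheme \<Rightarrow> 'i set \<Rightarrow> 'j set \<Rightarrow> ('i \<Rightarrow> 'j \<Rightarrow> 'a) \<Rightarrow> ('j \<Rightarrow> 'a) \<Rightarrow> bool" where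
  "in_row_span S I J A x \<longleftrightarrow>
    (\<exists>u\<in>I \<rightarrow> carrier S. \<forall>j\<in>J. ssum S (\<lambda>i. u i \<boxtimes>\<^bsub>S\<^esub> A i j) I = x j)"

text \<open>The column counterpart: \<open>A v = y\<close> for some \<open>v\<close>.\<close>

definition in_col_span ::
  "('a, 'm) add_mult_scheme \<Rightarrow> 'i set \<Rightarrow> 'j set \<Rightarrow> ('i \<Rightarrow> 'j \<Rightarrow> 'a) \<Rightarrow> ('i \<Rightarrow> 'a) \<Rightarrow> bool" where
  "in_col_span S I J A y \<longleftrightarrow>
    (\<exists>v\<in>J \<rightarrow> carrier S. \<forall>i\<in>I. ssum S (\<lambda>j. A i j \<boxtimes>\<^bsub>S\<^esub> v j) J = y i)"

text \<open>The conclusion of the row condition \<open>exact_row\<close>: \<open>A v = A v'\<close> but \<open>x v \<noteq> x v'\<close> for some \<open>v, v'\<close>.\<close>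

definition row_separated ::
  "('a, 'm) add_mult_scheme \<Rightarrow> 'i set \<Rightarrow> 'j set \<Rightarrow> ('i \<Rightarrow> 'j \<Rightarrow> 'a) \<Rightarrow> ('j \<Rightarrow> 'a) \<Rightarrow> bool" where
  "row_separated S I J A x \<longleftrightarrow>
    (\<exists>v\<in>J \<rightarrow> carrier S. \<exists>v'\<in>J \<rightarrow> carrier S.
      (\<forall>i\<in>I. ssum S (\<lambda>j. A i j \<boxtimes>\<^bsub>S\<^esub> v j) J = ssum S (\<lambda>j. A i j \<boxtimes>\<^bsub>S\<^esub> v' j) J)
      \<and> ssum S (\<lambda>j. x j \<boxtimes>\<^bsub>S\<^esub> v j) J \<noteq> ssum S (\<lambda>j. x j \<boxtimes>\<^bsub>S\<^esub> v' j) J)"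

text \<open>The conclusion of the column condition \<open>exact_col\<close>: \<open>u A = u' A\<close> but \<open>u y \<noteq> u' y\<close> for some \<open>u, u'\<close>.\<close>

definition col_separated ::
  "('a, 'm) add_mult_scheme \<Rightarrow> 'i set \<Rightarrow> 'j set \<Rightarrow> ('i \<Rightarrow> 'j \<Rightarrow> 'a) \<Rightarrow> ('i \<Rightarrow> 'a) \<Rightarrow> bool" where
  "col_separated S I J A y \<longleftrightarrow>
    (\<exists>u\<in>I \<rightarrow> carrier S. \<exists>u'\<in>I \<rightarrow> carrier S.
      (\<forall>j\<in>J. ssum S (\<lambda>i. u i \<boxtimes>\<^bsub>S\<^esub> A i j) I = ssum S (\<lambda>i. u' i \<boxtimes>\<^bsub>S\<^esub> A i j) I)
      \<and> ssum S (\<lambda>i. u i \<boxtimes>\<^bsub>S\<^esub> y i) I \<noteq> ssum S (\<lambda>i. u' i \<boxtimes>\<^bsub>S\<^esub> y i) I)"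

lemma smat_iff:
  "A \<in> smat S m n \<longleftrightarrow>
    dim_row A = m \<and> dim_col A = n \<and> (\<forall>i<m. \<forall>j<n. A $$ (i, j) \<in> carrier S)"
  by (fastforce simp: smat_def elements_mat_def)

lemma dim_smat_mult [simp]:
  "dim_row (smat_mult S A B) = dim_row A" "dim_col (smat_mult S A B) = dim_col B"
  by (simp_all add: smat_mult_def)

lemma index_smat_mult:
  "\<lbrakk>i < dim_row A; j < dim_col B\<rbrakk> \<Longrightarrow> smat_mult S A B $$ (i, j) =
    ssum S (\<lambda>k. A $$ (i, k) \<boxtimes>\<^bsub>S\<^esub> B $$ (k, j)) {..<dim_col A}"
  by (simp add: smat_mult_def)

lemma ex_bij_betw_lessThan:
  assumes "finite I" "I \<noteq> {}"
  obtains h and m :: nat where "bij_betw h {..<m} I" "0 < m"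
  using ex_bij_betw_nat_finite [OF assms(1)] assms
  by (metis atLeast0LessThan card_gt_0_iff)

context exact_semiring
begin

text \<open>Both exactness conditions pass from matrices to families by numbering the index sets.\<close>

lemma row_separated_family:
  assumes I: "finite I" "I \<noteq> {}" and J: "finite J" "J \<noteq> {}"
    and A: "\<And>i j. i \<in> I \<Longrightarrow> j \<in> J \<Longrightarrow> A i j \<in> carrier S"
    and x: "\<And>j. j \<in> J \<Longrightarrow> x j \<in> carrier S"
    and not_span: "\<not> in_row_span S I J A x"
  shows "row_separated S I J A x"
proof -
  obtain h and m :: nat where h: "bij_betw h {..<m} I" and m: "0 < m"
    by (rule ex_bij_betw_lessThan [OF I])
  obtain k and n :: nat where k: "bij_betw k {..<n} J" and n: "0 < n"
    by (rule ex_bij_betw_lessThan [OF J])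
  have hI: "h p \<in> I" if "p < m" for p using h that by (auto simp: bij_betw_def)
  have kJ: "k q \<in> J" if "q < n" for q using k that by (auto simp: bij_betw_def)
  obtain h' where h': "\<And>p. p < m \<Longrightarrow> h' (h p) = p" "\<And>i. i \<in> I \<Longrightarrow> h (h' i) = i"
      "\<And>i. i \<in> I \<Longrightarrow> h' i < m"
    using bij_betw_iff_bijections [THEN iffD1, OF h] by (metis lessThan_iff)
  obtain k' where k': "\<And>p. p < n \<Longrightarrow> k' (k p) = p" "\<And>j. j \<in> J \<Longrightarrow> k (k' j) = j"
      "\<And>j. j \<in> J \<Longrightarrow> k' j < n"
    using bij_betw_iff_bijections [THEN iffD1, OF k] by (metis lessThan_iff)
  have sumI: "ssum S (\<lambda>p. f (h p)) {..<m} = ssum S f I"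
    if "\<And>i. i \<in> I \<Longrightarrow> f i \<in> carrier S" for f
    using h m that by (intro ssum_reindex_bij_betw) auto
  have sumJ: "ssum S (\<lambda>q. f (k q)) {..<n} = ssum S f J"
    if "\<And>j. j \<in> J \<Longrightarrow> f j \<in> carrier S" for f
    using k n that by (intro ssum_reindex_bij_betw) auto
  define M where "M = mat m n (\<lambda>(p, q). A (h p) (k q))"
  define X where "X = mat 1 n (\<lambda>(p, q). x (k q))"
  have M: "M \<in> smat S m n" and X: "X \<in> smat S 1 n"
    using A x hI kJ by (auto simp: M_def X_def smat_iff)
  have "X \<notin> Row S M"
  proof
    assume "X \<in> Row S M"
    then obtain u where u: "u \<in> smat S 1 m" and X_eq: "X = smat_mult S u M"
      by (auto simp: Row_def M_def)
    define w where "w i = u $$ (0, h' i)" for i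
    have w: "w \<in> I \<rightarrow> carrier S" using u h' by (auto simp: w_def smat_iff)
    have "ssum S (\<lambda>i. w i \<boxtimes> A i j) I = x j" if j: "j \<in> J" for j
    proof -
      have "x j = X $$ (0, k' j)" using k' j by (simp add: X_def)
      also have "\<dots> = ssum S (\<lambda>p. u $$ (0, p) \<boxtimes> M $$ (p, k' j)) {..<m}"
        unfolding X_eq using u k' j by (subst index_smat_mult) (auto simp: smat_iff M_def)
      also have "\<dots> = ssum S (\<lambda>p. w (h p) \<boxtimes> A (h p) j) {..<m}"
        using m u w k' h' j hI A
        by (intro ssum_cong) (auto simp: M_def w_def smat_iff intro!: times_closed)
      also have "\<dots> = ssum S (\<lambda>i. w i \<boxtimes> A i j) I"
        using w A j by (intro sumI) (auto intro!: times_closed)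
      finally show ?thesis ..
    qed
    then show False using not_span w by (auto simp: in_row_span_def)
  qed
  then obtain V V' where V: "V \<in> smat S n 1" "V' \<in> smat S n 1"
    and MV: "smat_mult S M V = smat_mult S M V'" and XV: "smat_mult S X V \<noteq> smat_mult S X V'"
    using exact_row [OF m n M] X by blast
  define v where "v W j = W $$ (k' j, 0)" for W :: "'a mat" and j
  have v: "v W \<in> J \<rightarrow> carrier S" if "W \<in> smat S n 1" for W
    using that k' by (auto simp: v_def smat_iff)
  \<comment> \<open>Used twice: for the rows of \<open>M\<close>, and for the single row of \<open>X\<close>.\<close>
  have prod: "smat_mult S N W $$ (p, 0) = ssum S (\<lambda>j. a j \<boxtimes> v W j) J"
    if N: "p < dim_row N" "dim_col N = n" and W: "W \<in> smat S n 1"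
      and a: "\<And>j. j \<in> J \<Longrightarrow> a j \<in> carrier S" and Na: "\<And>q. q < n \<Longrightarrow> N $$ (p, q) = a (k q)"
    for N W p a
  proof -
    have "smat_mult S N W $$ (p, 0) = ssum S (\<lambda>q. N $$ (p, q) \<boxtimes> W $$ (q, 0)) {..<n}"
      using N W by (subst index_smat_mult) (auto simp: smat_iff)
    also have "\<dots> = ssum S (\<lambda>q. a (k q) \<boxtimes> v W (k q)) {..<n}"
      using n W k' kJ a v [OF W]
      by (intro ssum_cong) (auto simp: Na v_def smat_iff intro!: times_closed)
    also have "\<dots> = ssum S (\<lambda>j. a j \<boxtimes> v W j) J"
      using v [OF W] a by (intro sumJ) (auto intro!: times_closed)
    finally show ?thesis .
  qed
  have "ssum S (\<lambda>j. A i j \<boxtimes> v V j) J = ssum S (\<lambda>j. A i j \<boxtimes> v V' j) J" if i: "i \<in> I" for i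
  proof -
    have "smat_mult S M W $$ (h' i, 0) = ssum S (\<lambda>j. A i j \<boxtimes> v W j) J" if "W \<in> smat S n 1" for W
      using i h' A that by (intro prod) (auto simp: M_def)
    then show ?thesis using V MV by metis
  qed
  moreover have "ssum S (\<lambda>j. x j \<boxtimes> v V j) J \<noteq> ssum S (\<lambda>j. x j \<boxtimes> v V' j) J"
  proof
    assume eq: "ssum S (\<lambda>j. x j \<boxtimes> v V j) J = ssum S (\<lambda>j. x j \<boxtimes> v V' j) J"
    have "smat_mult S X W $$ (0, 0) = ssum S (\<lambda>j. x j \<boxtimes> v W j) J" if "W \<in> smat S n 1" for W
      using x that by (intro prod) (auto simp: X_def)
    then have "smat_mult S X V = smat_mult S X V'"
      using V eq by (intro eq_matI) (auto simp: smat_iff X_def)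
    then show False using XV by simp
  qed
  ultimately show ?thesis using v V unfolding row_separated_def
    by (intro bexI [of _ "v V"] bexI [of _ "v V'"]) auto
qed

lemma col_separated_family:
  assumes I: "finite I" "I \<noteq> {}" and J: "finite J" "J \<noteq> {}"
    and A: "\<And>i j. i \<in> I \<Longrightarrow> j \<in> J \<Longrightarrow> A i j \<in> carrier S"
    and y: "\<And>i. i \<in> I \<Longrightarrow> y i \<in> carrier S"
    and not_span: "\<not> in_col_span S I J A y"
  shows "col_separated S I J A y"
proof -
  obtain h and m :: nat where h: "bij_betw h {..<m} I" and m: "0 < m"
    by (rule ex_bij_betw_lessThan [OF I])
  obtain k and n :: nat where k: "bij_betw k {..<n} J" and n: "0 < n"
    by (rule ex_bij_betw_lessThan [OF J])
  have hI: "h p \<in> I" if "p < m" for p using h that by (auto simp: bij_betw_def)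
  have kJ: "k q \<in> J" if "q < n" for q using k that by (auto simp: bij_betw_def)
  obtain h' where h': "\<And>p. p < m \<Longrightarrow> h' (h p) = p" "\<And>i. i \<in> I \<Longrightarrow> h (h' i) = i"
      "\<And>i. i \<in> I \<Longrightarrow> h' i < m"
    using bij_betw_iff_bijections [THEN iffD1, OF h] by (metis lessThan_iff)
  obtain k' where k': "\<And>p. p < n \<Longrightarrow> k' (k p) = p" "\<And>j. j \<in> J \<Longrightarrow> k (k' j) = j"
      "\<And>j. j \<in> J \<Longrightarrow> k' j < n"
    using bij_betw_iff_bijections [THEN iffD1, OF k] by (metis lessThan_iff)
  have sumI: "ssum S (\<lambda>p. f (h p)) {..<m} = ssum S f I"
    if "\<And>i. i \<in> I \<Longrightarrow> f i \<in> carrier S" for f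
    using h m that by (intro ssum_reindex_bij_betw) auto
  have sumJ: "ssum S (\<lambda>q. f (k q)) {..<n} = ssum S f J"
    if "\<And>j. j \<in> J \<Longrightarrow> f j \<in> carrier S" for f
    using k n that by (intro ssum_reindex_bij_betw) auto
  define M where "M = mat m n (\<lambda>(p, q). A (h p) (k q))"
  define Y where "Y = mat m 1 (\<lambda>(p, q). y (h p))"
  have M: "M \<in> smat S m n" and Y: "Y \<in> smat S m 1"
    using A y hI kJ by (auto simp: M_def Y_def smat_iff)
  have "Y \<notin> Col S M"
  proof
    assume "Y \<in> Col S M"
    then obtain v where v: "v \<in> smat S n 1" and Y_eq: "Y = smat_mult S M v"
      by (auto simp: Col_def M_def)
    define w where "w j = v $$ (k' j, 0)" for j
    have w: "w \<in> J \<rightarrow> carrier S" using v k' by (auto simp: w_def smat_iff)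
    have "ssum S (\<lambda>j. A i j \<boxtimes> w j) J = y i" if i: "i \<in> I" for i
    proof -
      have "y i = Y $$ (h' i, 0)" using h' i by (simp add: Y_def)
      also have "\<dots> = ssum S (\<lambda>q. M $$ (h' i, q) \<boxtimes> v $$ (q, 0)) {..<n}"
        unfolding Y_eq using v h' i by (subst index_smat_mult) (auto simp: smat_iff M_def)
      also have "\<dots> = ssum S (\<lambda>q. A i (k q) \<boxtimes> w (k q)) {..<n}"
        using n v w k' h' i kJ A
        by (intro ssum_cong) (auto simp: M_def w_def smat_iff intro!: times_closed)
      also have "\<dots> = ssum S (\<lambda>j. A i j \<boxtimes> w j) J"
        using w A i by (intro sumJ) (auto intro!: times_closed)
      finally show ?thesis ..
    qed
    then show False using not_span w by (auto simp: in_col_span_def)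
  qed
  then obtain U U' where U: "U \<in> smat S 1 m" "U' \<in> smat S 1 m"
    and UM: "smat_mult S U M = smat_mult S U' M" and UY: "smat_mult S U Y \<noteq> smat_mult S U' Y"
    using exact_col [OF m n M] Y by blast
  define u where "u W i = W $$ (0, h' i)" for W :: "'a mat" and i
  have u: "u W \<in> I \<rightarrow> carrier S" if "W \<in> smat S 1 m" for W
    using that h' by (auto simp: u_def smat_iff)
  \<comment> \<open>Used twice: for the columns of \<open>M\<close>, and for the single column of \<open>Y\<close>.\<close>
  have prod: "smat_mult S W N $$ (0, q) = ssum S (\<lambda>i. u W i \<boxtimes> a i) I"
    if N: "q < dim_col N" and W: "W \<in> smat S 1 m"
      and a: "\<And>i. i \<in> I \<Longrightarrow> a i \<in> carrier S" and Na: "\<And>p. p < m \<Longrightarrow> N $$ (p, q) = a (h p)"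
    for N W q a
  proof -
    have "smat_mult S W N $$ (0, q) = ssum S (\<lambda>p. W $$ (0, p) \<boxtimes> N $$ (p, q)) {..<m}"
      using N W by (subst index_smat_mult) (auto simp: smat_iff)
    also have "\<dots> = ssum S (\<lambda>p. u W (h p) \<boxtimes> a (h p)) {..<m}"
      using m W h' hI a u [OF W]
      by (intro ssum_cong) (auto simp: Na u_def smat_iff intro!: times_closed)
    also have "\<dots> = ssum S (\<lambda>i. u W i \<boxtimes> a i) I"
      using u [OF W] a by (intro sumI) (auto intro!: times_closed)
    finally show ?thesis .
  qed
  have "ssum S (\<lambda>i. u U i \<boxtimes> A i j) I = ssum S (\<lambda>i. u U' i \<boxtimes> A i j) I" if j: "j \<in> J" for j
  proof -
    have "smat_mult S W M $$ (0, k' j) = ssum S (\<lambda>i. u W i \<boxtimes> A i j) I" if "W \<in> smat S 1 m" for W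
      using j k' A that by (intro prod) (auto simp: M_def)
    then show ?thesis using U UM by metis
  qed
  moreover have "ssum S (\<lambda>i. u U i \<boxtimes> y i) I \<noteq> ssum S (\<lambda>i. u U' i \<boxtimes> y i) I"
  proof
    assume eq: "ssum S (\<lambda>i. u U i \<boxtimes> y i) I = ssum S (\<lambda>i. u U' i \<boxtimes> y i) I"
    have "smat_mult S W Y $$ (0, 0) = ssum S (\<lambda>i. u W i \<boxtimes> y i) I" if "W \<in> smat S 1 m" for W
      using y that by (intro prod) (auto simp: Y_def)
    then have "smat_mult S U Y = smat_mult S U' Y"
      using U eq by (intro eq_matI) (auto simp: smat_iff Y_def)
    then show False using UY by simp
  qed
  ultimately show ?thesis using u U unfolding col_separated_def
    by (intro bexI [of _ "u U"] bexI [of _ "u U'"]) auto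
qed

end

context local_semiring
begin

text \<open>Conversely, families indexed by initial segments of the naturals suffice for exactness.\<close>

lemma exact_semiringI:
  assumes row: "\<And>(m::nat) (n::nat) A x. \<lbrakk>0 < m; 0 < n; \<And>i j. i < m \<Longrightarrow> j < n \<Longrightarrow> A i j \<in> carrier S;
      \<And>j. j < n \<Longrightarrow> x j \<in> carrier S; \<not> in_row_span S {..<m} {..<n} A x\<rbrakk>
      \<Longrightarrow> row_separated S {..<m} {..<n} A x"
    and col: "\<And>(m::nat) (n::nat) A y. \<lbrakk>0 < m; 0 < n; \<And>i j. i < m \<Longrightarrow> j < n \<Longrightarrow> A i j \<in> carrier S;
      \<And>i. i < m \<Longrightarrow> y i \<in> carrier S; \<not> in_col_span S {..<m} {..<n} A y\<rbrakk>
      \<Longrightarrow> col_separated S {..<m} {..<n} A y"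
  shows "exact_semiring S"
proof
  fix m n :: nat and A x
  assume mn: "0 < m" "0 < n" and A: "A \<in> smat S m n" and x: "x \<in> smat S 1 n - Row S A"
  let ?A = "\<lambda>i j. A $$ (i, j)" and ?x = "\<lambda>j. x $$ (0, j)"
  have "\<not> in_row_span S {..<m} {..<n} ?A ?x"
  proof
    assume "in_row_span S {..<m} {..<n} ?A ?x"
    then obtain u where u: "u \<in> {..<m} \<rightarrow> carrier S"
      and eq: "\<And>j. j < n \<Longrightarrow> ssum S (\<lambda>i. u i \<boxtimes> A $$ (i, j)) {..<m} = x $$ (0, j)"
      by (auto simp: in_row_span_def)
    define U where "U = mat 1 m (\<lambda>(_, i). u i)"
    have U: "U \<in> smat S 1 m" using u by (auto simp: U_def smat_iff)
    have "smat_mult S U A = x"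
    proof (rule eq_matI)
      fix p j assume "p < dim_row x" "j < dim_col x"
      then have p: "p = 0" "j < n" using x by (auto simp: smat_iff)
      have "smat_mult S U A $$ (0, j) = ssum S (\<lambda>i. U $$ (0, i) \<boxtimes> A $$ (i, j)) {..<m}"
        using p A by (subst index_smat_mult) (auto simp: U_def smat_iff)
      also have "\<dots> = ssum S (\<lambda>i. u i \<boxtimes> A $$ (i, j)) {..<m}"
        using mn u A p by (intro ssum_cong) (auto simp: U_def smat_iff intro!: times_closed)
      finally show "smat_mult S U A $$ (p, j) = x $$ (p, j)" using eq p by simp
    qed (use A x in \<open>auto simp: smat_iff U_def\<close>)
    moreover have "dim_row A = m" using A by (simp add: smat_iff)
    ultimately have "x \<in> Row S A" using U unfolding Row_def by blast
    then show False using x by simp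
  qed
  then have "row_separated S {..<m} {..<n} ?A ?x"
    using mn A x by (intro row) (auto simp: smat_iff)
  then obtain v v' where v: "v \<in> {..<n} \<rightarrow> carrier S" "v' \<in> {..<n} \<rightarrow> carrier S"
    and Av: "\<And>i. i < m \<Longrightarrow> ssum S (\<lambda>j. A $$ (i, j) \<boxtimes> v j) {..<n}
      = ssum S (\<lambda>j. A $$ (i, j) \<boxtimes> v' j) {..<n}"
    and xv: "ssum S (\<lambda>j. x $$ (0, j) \<boxtimes> v j) {..<n} \<noteq> ssum S (\<lambda>j. x $$ (0, j) \<boxtimes> v' j) {..<n}"
    by (auto simp: row_separated_def)
  define V where "V w = mat n 1 (\<lambda>(j, _). w j)" for w :: "nat \<Rightarrow> 'a"
  have V: "V w \<in> smat S n 1" if "w \<in> {..<n} \<rightarrow> carrier S" for w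
    using that by (auto simp: V_def smat_iff)
  have prod: "smat_mult S N (V w) $$ (p, 0) = ssum S (\<lambda>j. N $$ (p, j) \<boxtimes> w j) {..<n}"
    if "N \<in> smat S l n" "p < l" "w \<in> {..<n} \<rightarrow> carrier S" for N l p w
  proof -
    have "smat_mult S N (V w) $$ (p, 0) = ssum S (\<lambda>j. N $$ (p, j) \<boxtimes> V w $$ (j, 0)) {..<n}"
      using that by (subst index_smat_mult) (auto simp: V_def smat_iff)
    also have "\<dots> = ssum S (\<lambda>j. N $$ (p, j) \<boxtimes> w j) {..<n}"
      using that mn by (intro ssum_cong) (auto simp: V_def smat_iff intro!: times_closed)
    finally show ?thesis .
  qed
  have "smat_mult S A (V v) = smat_mult S A (V v')"
    using A v Av prod [OF A] by (intro eq_matI) (auto simp: V_def smat_iff)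
  moreover have "smat_mult S x (V v) \<noteq> smat_mult S x (V v')"
    using x v xv prod [of x 1 0 v] prod [of x 1 0 v'] by auto
  ultimately show "\<exists>v\<in>smat S n 1. \<exists>v'\<in>smat S n 1.
      smat_mult S A v = smat_mult S A v' \<and> smat_mult S x v \<noteq> smat_mult S x v'"
    using V v by blast
next
  fix m n :: nat and A y
  assume mn: "0 < m" "0 < n" and A: "A \<in> smat S m n" and y: "y \<in> smat S m 1 - Col S A"
  let ?A = "\<lambda>i j. A $$ (i, j)" and ?y = "\<lambda>i. y $$ (i, 0)"
  have "\<not> in_col_span S {..<m} {..<n} ?A ?y"
  proof
    assume "in_col_span S {..<m} {..<n} ?A ?y"
    then obtain v where v: "v \<in> {..<n} \<rightarrow> carrier S"
      and eq: "\<And>i. i < m \<Longrightarrow> ssum S (\<lambda>j. A $$ (i, j) \<boxtimes> v j) {..<n} = y $$ (i, 0)"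
      by (auto simp: in_col_span_def)
    define V where "V = mat n 1 (\<lambda>(j, _). v j)"
    have V: "V \<in> smat S n 1" using v by (auto simp: V_def smat_iff)
    have "smat_mult S A V = y"
    proof (rule eq_matI)
      fix i q assume "i < dim_row y" "q < dim_col y"
      then have q: "q = 0" "i < m" using y by (auto simp: smat_iff)
      have "smat_mult S A V $$ (i, 0) = ssum S (\<lambda>j. A $$ (i, j) \<boxtimes> V $$ (j, 0)) {..<n}"
        using q A by (subst index_smat_mult) (auto simp: V_def smat_iff)
      also have "\<dots> = ssum S (\<lambda>j. A $$ (i, j) \<boxtimes> v j) {..<n}"
        using mn v A q by (intro ssum_cong) (auto simp: V_def smat_iff intro!: times_closed)
      finally show "smat_mult S A V $$ (i, q) = y $$ (i, q)" using eq q by simp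
    qed (use A y in \<open>auto simp: smat_iff V_def\<close>)
    moreover have "dim_col A = n" using A by (simp add: smat_iff)
    ultimately have "y \<in> Col S A" using V unfolding Col_def by blast
    then show False using y by simp
  qed
  then have "col_separated S {..<m} {..<n} ?A ?y"
    using mn A y by (intro col) (auto simp: smat_iff)
  then obtain u u' where u: "u \<in> {..<m} \<rightarrow> carrier S" "u' \<in> {..<m} \<rightarrow> carrier S"
    and uA: "\<And>j. j < n \<Longrightarrow> ssum S (\<lambda>i. u i \<boxtimes> A $$ (i, j)) {..<m}
      = ssum S (\<lambda>i. u' i \<boxtimes> A $$ (i, j)) {..<m}"
    and uy: "ssum S (\<lambda>i. u i \<boxtimes> y $$ (i, 0)) {..<m} \<noteq> ssum S (\<lambda>i. u' i \<boxtimes> y $$ (i, 0)) {..<m}"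
    by (auto simp: col_separated_def)
  define U where "U w = mat 1 m (\<lambda>(_, i). w i)" for w :: "nat \<Rightarrow> 'a"
  have U: "U w \<in> smat S 1 m" if "w \<in> {..<m} \<rightarrow> carrier S" for w
    using that by (auto simp: U_def smat_iff)
  have prod: "smat_mult S (U w) N $$ (0, q) = ssum S (\<lambda>i. w i \<boxtimes> N $$ (i, q)) {..<m}"
    if "N \<in> smat S m l" "q < l" "w \<in> {..<m} \<rightarrow> carrier S" for N l q w
  proof -
    have "smat_mult S (U w) N $$ (0, q) = ssum S (\<lambda>i. U w $$ (0, i) \<boxtimes> N $$ (i, q)) {..<m}"
      using that by (subst index_smat_mult) (auto simp: U_def smat_iff)
    also have "\<dots> = ssum S (\<lambda>i. w i \<boxtimes> N $$ (i, q)) {..<m}"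
      using that mn by (intro ssum_cong) (auto simp: U_def smat_iff intro!: times_closed)
    finally show ?thesis .
  qed
  have "smat_mult S (U u) A = smat_mult S (U u') A"
    using A u uA prod [OF A] by (intro eq_matI) (auto simp: U_def smat_iff)
  moreover have "smat_mult S (U u) y \<noteq> smat_mult S (U u') y"
    using y u uy prod [of y 1 0 u] prod [of y 1 0 u'] by auto
  ultimately show "\<exists>u\<in>smat S 1 m. \<exists>u'\<in>smat S 1 m.
      smat_mult S u A = smat_mult S u' A \<and> smat_mult S u y \<noteq> smat_mult S u' y"
    using U u by blast
qed

end

section \<open>The group semiring\<close>

text \<open>Exactness is not assumed here; the group semiring, called \<open>T\<close> below, is again a semiring
  with local identities in this generality.\<close>

locale semiring_finite_group = local_semiring S + group G
  for S :: "('a, 'm) add_mult_scheme" (structure) and G :: "('g, 'k) monoid_scheme" +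
  assumes finite_group: "finite (carrier G)"
begin

abbreviation T :: "('g \<Rightarrow> 'a) add_mult" where
  "T \<equiv> group_semiring S G"

lemma group_nonempty: "carrier G \<noteq> {}"
  using one_closed by blast

lemma carrier_T: "carrier T = carrier G \<rightarrow>\<^sub>E carrier S"
  by (simp add: group_semiring_def)

lemma T_apply: "\<lbrakk>f \<in> carrier T; \<alpha> \<in> carrier G\<rbrakk> \<Longrightarrow> f \<alpha> \<in> carrier S"
  by (auto simp: carrier_T)

lemma T_eqI:
  "\<lbrakk>f \<in> carrier T; g \<in> carrier T; \<And>\<alpha>. \<alpha> \<in> carrier G \<Longrightarrow> f \<alpha> = g \<alpha>\<rbrakk> \<Longrightarrow> f = g"
  unfolding carrier_T by (rule PiE_ext)

lemma plus_T: "\<alpha> \<in> carrier G \<Longrightarrow> (f \<boxplus>\<^bsub>T\<^esub> g) \<alpha> = f \<alpha> \<boxplus> g \<alpha>"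
  by (simp add: group_semiring_def)

lemma times_T:
  "\<alpha> \<in> carrier G \<Longrightarrow>
    (f \<boxtimes>\<^bsub>T\<^esub> g) \<alpha> = ssum S (\<lambda>\<beta>. f \<beta> \<boxtimes> g (inv\<^bsub>G\<^esub> \<beta> \<otimes>\<^bsub>G\<^esub> \<alpha>)) (carrier G)"
  by (simp add: group_semiring_def)

lemma plus_T_closed: "\<lbrakk>f \<in> carrier T; g \<in> carrier T\<rbrakk> \<Longrightarrow> f \<boxplus>\<^bsub>T\<^esub> g \<in> carrier T"
  by (auto simp: group_semiring_def intro!: plus_closed)

lemma times_T_closed: "\<lbrakk>f \<in> carrier T; g \<in> carrier T\<rbrakk> \<Longrightarrow> f \<boxtimes>\<^bsub>T\<^esub> g \<in> carrier T"
  unfolding group_semiring_def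
  by (auto intro!: ssum_closed times_closed finite_group)

lemma bij_betw_mult_left:
  assumes "\<alpha> \<in> carrier G"
  shows "bij_betw (\<lambda>\<gamma>. \<alpha> \<otimes>\<^bsub>G\<^esub> \<gamma>) (carrier G) (carrier G)"
  by (rule bij_betw_byWitness [where f' = "\<lambda>\<gamma>. inv\<^bsub>G\<^esub> \<alpha> \<otimes>\<^bsub>G\<^esub> \<gamma>"])
    (use assms in \<open>auto simp: m_assoc [symmetric]\<close>)

lemma bij_betw_mult_right:
  assumes "\<alpha> \<in> carrier G"
  shows "bij_betw (\<lambda>\<gamma>. \<gamma> \<otimes>\<^bsub>G\<^esub> \<alpha>) (carrier G) (carrier G)"
  by (rule bij_betw_byWitness [where f' = "\<lambda>\<gamma>. \<gamma> \<otimes>\<^bsub>G\<^esub> inv\<^bsub>G\<^esub> \<alpha>"])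
    (use assms in \<open>auto simp: m_assoc\<close>)

lemma bij_betw_mult_inv:
  assumes "\<alpha> \<in> carrier G"
  shows "bij_betw (\<lambda>\<gamma>. \<alpha> \<otimes>\<^bsub>G\<^esub> inv\<^bsub>G\<^esub> \<gamma>) (carrier G) (carrier G)"
  by (rule bij_betw_byWitness [where f' = "\<lambda>\<gamma>. inv\<^bsub>G\<^esub> \<gamma> \<otimes>\<^bsub>G\<^esub> \<alpha>"])
    (use assms in \<open>auto simp: inv_mult_group m_assoc, simp_all add: m_assoc [symmetric]\<close>)

text \<open>The convolution summed over the argument of the second factor.\<close>

lemma times_T':
  assumes f: "f \<in> carrier T" and g: "g \<in> carrier T" and \<alpha>: "\<alpha> \<in> carrier G"
  shows "(f \<boxtimes>\<^bsub>T\<^esub> g) \<alpha> = ssum S (\<lambda>\<gamma>. f (\<alpha> \<otimes>\<^bsub>G\<^esub> inv\<^bsub>G\<^esub> \<gamma>) \<boxtimes> g \<gamma>) (carrier G)"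
proof -
  have inv: "inv\<^bsub>G\<^esub> (\<alpha> \<otimes>\<^bsub>G\<^esub> inv\<^bsub>G\<^esub> \<gamma>) \<otimes>\<^bsub>G\<^esub> \<alpha> = \<gamma>" if "\<gamma> \<in> carrier G" for \<gamma>
    using that \<alpha> by (simp add: inv_mult_group m_assoc)
  have "(f \<boxtimes>\<^bsub>T\<^esub> g) \<alpha> = ssum S (\<lambda>\<gamma>. f (\<alpha> \<otimes>\<^bsub>G\<^esub> inv\<^bsub>G\<^esub> \<gamma>)
      \<boxtimes> g (inv\<^bsub>G\<^esub> (\<alpha> \<otimes>\<^bsub>G\<^esub> inv\<^bsub>G\<^esub> \<gamma>) \<otimes>\<^bsub>G\<^esub> \<alpha>)) (carrier G)"
    unfolding times_T [OF \<alpha>]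
    by (rule ssum_reindex_bij_betw [OF bij_betw_mult_inv [OF \<alpha>], symmetric])
      (use \<alpha> in \<open>auto intro!: times_closed T_apply [OF f] T_apply [OF g] finite_group\<close>)
  also have "\<dots> = ssum S (\<lambda>\<gamma>. f (\<alpha> \<otimes>\<^bsub>G\<^esub> inv\<^bsub>G\<^esub> \<gamma>) \<boxtimes> g \<gamma>) (carrier G)"
    using \<alpha> by (intro ssum_cong) (auto simp: inv intro!: times_closed T_apply [OF f] T_apply [OF g] finite_group)
  finally show ?thesis .
qed

lemma times_T_assoc:
  assumes f: "f \<in> carrier T" and g: "g \<in> carrier T" and h: "h \<in> carrier T"
  shows "(f \<boxtimes>\<^bsub>T\<^esub> g) \<boxtimes>\<^bsub>T\<^esub> h = f \<boxtimes>\<^bsub>T\<^esub> (g \<boxtimes>\<^bsub>T\<^esub> h)"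
proof (rule T_eqI)
  fix \<alpha> assume \<alpha>: "\<alpha> \<in> carrier G"
  let ?t = "\<lambda>\<beta> \<gamma>. f \<gamma> \<boxtimes> (g (inv\<^bsub>G\<^esub> \<gamma> \<otimes>\<^bsub>G\<^esub> \<beta>) \<boxtimes> h (inv\<^bsub>G\<^esub> \<beta> \<otimes>\<^bsub>G\<^esub> \<alpha>))"
  note fin = finite_group group_nonempty
  note cl = T_apply [OF f] T_apply [OF g] T_apply [OF h] times_closed \<alpha> ssum_closed fin
  have "((f \<boxtimes>\<^bsub>T\<^esub> g) \<boxtimes>\<^bsub>T\<^esub> h) \<alpha> = ssum S (\<lambda>\<beta>. ssum S (?t \<beta>) (carrier G)) (carrier G)"
    unfolding times_T [OF \<alpha>]
    by (intro ssum_cong) (simp_all add: times_T ssum_times_right times_assoc cl cong: ssum_cong)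
  also have "\<dots> = ssum S (\<lambda>\<gamma>. ssum S (\<lambda>\<beta>. ?t \<beta> \<gamma>) (carrier G)) (carrier G)"
    by (intro ssum_swap) (simp_all add: cl)
  also have "\<dots> = ssum S (\<lambda>\<gamma>. f \<gamma> \<boxtimes> (g \<boxtimes>\<^bsub>T\<^esub> h) (inv\<^bsub>G\<^esub> \<gamma> \<otimes>\<^bsub>G\<^esub> \<alpha>)) (carrier G)"
  proof (intro ssum_cong)
    fix \<gamma> assume \<gamma>: "\<gamma> \<in> carrier G"
    let ?s = "\<lambda>\<delta>. g \<delta> \<boxtimes> h (inv\<^bsub>G\<^esub> \<delta> \<otimes>\<^bsub>G\<^esub> (inv\<^bsub>G\<^esub> \<gamma> \<otimes>\<^bsub>G\<^esub> \<alpha>))"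
    have "(g \<boxtimes>\<^bsub>T\<^esub> h) (inv\<^bsub>G\<^esub> \<gamma> \<otimes>\<^bsub>G\<^esub> \<alpha>)
        = ssum S (\<lambda>\<beta>. ?s (inv\<^bsub>G\<^esub> \<gamma> \<otimes>\<^bsub>G\<^esub> \<beta>)) (carrier G)"
      using \<gamma> \<alpha> unfolding times_T [OF m_closed [OF inv_closed [OF \<gamma>] \<alpha>]]
      by (intro ssum_reindex_bij_betw [symmetric] bij_betw_mult_left) (simp_all add: cl)
    also have "\<dots> = ssum S (\<lambda>\<beta>. g (inv\<^bsub>G\<^esub> \<gamma> \<otimes>\<^bsub>G\<^esub> \<beta>) \<boxtimes> h (inv\<^bsub>G\<^esub> \<beta> \<otimes>\<^bsub>G\<^esub> \<alpha>)) (carrier G)"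
    proof (intro ssum_cong)
      fix \<beta> assume \<beta>: "\<beta> \<in> carrier G"
      have "inv\<^bsub>G\<^esub> (inv\<^bsub>G\<^esub> \<gamma> \<otimes>\<^bsub>G\<^esub> \<beta>) \<otimes>\<^bsub>G\<^esub> (inv\<^bsub>G\<^esub> \<gamma> \<otimes>\<^bsub>G\<^esub> \<alpha>)
          = inv\<^bsub>G\<^esub> \<beta> \<otimes>\<^bsub>G\<^esub> (\<gamma> \<otimes>\<^bsub>G\<^esub> (inv\<^bsub>G\<^esub> \<gamma> \<otimes>\<^bsub>G\<^esub> \<alpha>))"
        using \<alpha> \<beta> \<gamma> by (simp add: inv_mult_group m_assoc)
      also have "\<gamma> \<otimes>\<^bsub>G\<^esub> (inv\<^bsub>G\<^esub> \<gamma> \<otimes>\<^bsub>G\<^esub> \<alpha>) = \<alpha>"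
        using \<alpha> \<gamma> by (simp add: m_assoc [symmetric])
      finally show "?s (inv\<^bsub>G\<^esub> \<gamma> \<otimes>\<^bsub>G\<^esub> \<beta>)
          = g (inv\<^bsub>G\<^esub> \<gamma> \<otimes>\<^bsub>G\<^esub> \<beta>) \<boxtimes> h (inv\<^bsub>G\<^esub> \<beta> \<otimes>\<^bsub>G\<^esub> \<alpha>)"
        using \<alpha> \<beta> \<gamma> by simp
    qed (use \<gamma> in \<open>simp_all add: cl\<close>)
    finally show "ssum S (\<lambda>\<beta>. ?t \<beta> \<gamma>) (carrier G)
        = f \<gamma> \<boxtimes> (g \<boxtimes>\<^bsub>T\<^esub> h) (inv\<^bsub>G\<^esub> \<gamma> \<otimes>\<^bsub>G\<^esub> \<alpha>)"
      using \<gamma> by (simp add: ssum_times_left cl)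
  qed (simp_all add: cl T_apply [OF times_T_closed [OF g h]])
  also have "\<dots> = (f \<boxtimes>\<^bsub>T\<^esub> (g \<boxtimes>\<^bsub>T\<^esub> h)) \<alpha>"
    by (rule times_T [OF \<alpha>, symmetric])
  finally show "((f \<boxtimes>\<^bsub>T\<^esub> g) \<boxtimes>\<^bsub>T\<^esub> h) \<alpha> = (f \<boxtimes>\<^bsub>T\<^esub> (g \<boxtimes>\<^bsub>T\<^esub> h)) \<alpha>" .
qed (simp_all add: times_T_closed f g h)

lemma local_identities_T:
  assumes L: "L \<subseteq> carrier T" "finite L" "L \<noteq> {}"
  shows "\<exists>z\<in>carrier T. \<exists>e\<in>carrier T. \<forall>f\<in>L. \<forall>g\<in>L.
    f \<boxplus>\<^bsub>T\<^esub> z \<boxtimes>\<^bsub>T\<^esub> g = f \<and> e \<boxtimes>\<^bsub>T\<^esub> f = f \<and> f \<boxplus>\<^bsub>T\<^esub> g \<boxtimes>\<^bsub>T\<^esub> z = f \<and> f \<boxtimes>\<^bsub>T\<^esub> e = f"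
proof -
  define V where "V = (\<Union>f\<in>L. f ` carrier G)"
  have "V \<subseteq> carrier S" "finite V" "V \<noteq> {}"
    using L finite_group group_nonempty T_apply by (auto simp: V_def)
  from local_identities [OF this] obtain z e where z: "z \<in> carrier S" and e: "e \<in> carrier S"
    and id: "\<And>a b. a \<in> V \<Longrightarrow> b \<in> V \<Longrightarrow>
      a \<boxplus> z \<boxtimes> b = a \<and> e \<boxtimes> a = a \<and> a \<boxplus> b \<boxtimes> z = a \<and> a \<boxtimes> e = a"
    by blast
  have id_e: "e \<boxtimes> a = a" "a \<boxtimes> e = a" if "a \<in> V" for a
    using id [OF that that] by auto
  have in_V: "f \<alpha> \<in> V" if "f \<in> L" "\<alpha> \<in> carrier G" for f \<alpha>
    using that by (auto simp: V_def)
  \<comment> \<open>\<open>Z\<close> is the local zero and \<open>E\<close> the local identity: every unwanted summand has a factor \<open>z\<close>.\<close>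
  define Z where "Z = (\<lambda>\<alpha>\<in>carrier G. z)"
  define E where "E = (\<lambda>\<alpha>\<in>carrier G. if \<alpha> = \<one>\<^bsub>G\<^esub> then e else z)"
  have Z: "Z \<in> carrier T" and E: "E \<in> carrier T"
    using z e by (auto simp: Z_def E_def carrier_T)
  have "f \<boxplus>\<^bsub>T\<^esub> Z \<boxtimes>\<^bsub>T\<^esub> g = f \<and> E \<boxtimes>\<^bsub>T\<^esub> f = f \<and> f \<boxplus>\<^bsub>T\<^esub> g \<boxtimes>\<^bsub>T\<^esub> Z = f \<and> f \<boxtimes>\<^bsub>T\<^esub> E = f"
    if fL: "f \<in> L" and gL: "g \<in> L" for f g
  proof -
    have f: "f \<in> carrier T" and g: "g \<in> carrier T" using L that by auto
    note cl = finite_group group_nonempty T_apply [OF f] T_apply [OF g] z e times_closed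
    have "f \<boxplus>\<^bsub>T\<^esub> Z \<boxtimes>\<^bsub>T\<^esub> g = f"
    proof (rule T_eqI)
      fix \<alpha> assume \<alpha>: "\<alpha> \<in> carrier G"
      have "f \<alpha> \<boxplus> ssum S (\<lambda>\<beta>. Z \<beta> \<boxtimes> g (inv\<^bsub>G\<^esub> \<beta> \<otimes>\<^bsub>G\<^esub> \<alpha>)) (carrier G) = f \<alpha>"
        by (rule ssum_absorb) (use \<alpha> in \<open>simp_all add: cl Z_def id in_V fL gL\<close>)
      then show "(f \<boxplus>\<^bsub>T\<^esub> Z \<boxtimes>\<^bsub>T\<^esub> g) \<alpha> = f \<alpha>" using \<alpha> by (simp add: plus_T times_T)
    qed (simp_all add: f g Z plus_T_closed times_T_closed)
    moreover have "f \<boxplus>\<^bsub>T\<^esub> g \<boxtimes>\<^bsub>T\<^esub> Z = f"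
    proof (rule T_eqI)
      fix \<alpha> assume \<alpha>: "\<alpha> \<in> carrier G"
      have "f \<alpha> \<boxplus> ssum S (\<lambda>\<beta>. g \<beta> \<boxtimes> Z (inv\<^bsub>G\<^esub> \<beta> \<otimes>\<^bsub>G\<^esub> \<alpha>)) (carrier G) = f \<alpha>"
        by (rule ssum_absorb) (use \<alpha> in \<open>simp_all add: cl Z_def id in_V fL gL\<close>)
      then show "(f \<boxplus>\<^bsub>T\<^esub> g \<boxtimes>\<^bsub>T\<^esub> Z) \<alpha> = f \<alpha>" using \<alpha> by (simp add: plus_T times_T)
    qed (simp_all add: f g Z plus_T_closed times_T_closed)
    moreover have "E \<boxtimes>\<^bsub>T\<^esub> f = f"
    proof (rule T_eqI)
      fix \<alpha> assume \<alpha>: "\<alpha> \<in> carrier G"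
      have "(E \<boxtimes>\<^bsub>T\<^esub> f) \<alpha> = E \<one>\<^bsub>G\<^esub> \<boxtimes> f (inv\<^bsub>G\<^esub> \<one>\<^bsub>G\<^esub> \<otimes>\<^bsub>G\<^esub> \<alpha>)"
        unfolding times_T [OF \<alpha>]
        by (rule ssum_eq_dominant) (use \<alpha> in \<open>simp_all add: cl E_def id id_e in_V fL\<close>)
      then show "(E \<boxtimes>\<^bsub>T\<^esub> f) \<alpha> = f \<alpha>" using \<alpha> by (simp add: E_def id id_e in_V fL)
    qed (simp_all add: f E times_T_closed)
    moreover have "f \<boxtimes>\<^bsub>T\<^esub> E = f"
    proof (rule T_eqI)
      fix \<alpha> assume \<alpha>: "\<alpha> \<in> carrier G"
      have "(f \<boxtimes>\<^bsub>T\<^esub> E) \<alpha> = f (\<alpha> \<otimes>\<^bsub>G\<^esub> inv\<^bsub>G\<^esub> \<one>\<^bsub>G\<^esub>) \<boxtimes> E \<one>\<^bsub>G\<^esub>"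
        unfolding times_T' [OF f E \<alpha>]
        by (rule ssum_eq_dominant) (use \<alpha> in \<open>simp_all add: cl E_def id id_e in_V fL\<close>)
      then show "(f \<boxtimes>\<^bsub>T\<^esub> E) \<alpha> = f \<alpha>" using \<alpha> by (simp add: E_def id id_e in_V fL)
    qed (simp_all add: f E times_T_closed)
    ultimately show ?thesis by blast
  qed
  then show ?thesis using Z E by blast
qed

lemma local_semiring_T: "local_semiring T"
proof
  fix f g h assume f: "f \<in> carrier T" and g: "g \<in> carrier T" and h: "h \<in> carrier T"
  note cl = T_apply [OF f] T_apply [OF g] T_apply [OF h]
    finite_group group_nonempty plus_closed times_closed
  show "(f \<boxplus>\<^bsub>T\<^esub> g) \<boxplus>\<^bsub>T\<^esub> h = f \<boxplus>\<^bsub>T\<^esub> (g \<boxplus>\<^bsub>T\<^esub> h)"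
    by (rule T_eqI) (simp_all add: plus_T plus_assoc plus_T_closed f g h cl)
  show "(f \<boxplus>\<^bsub>T\<^esub> g) \<boxtimes>\<^bsub>T\<^esub> h = f \<boxtimes>\<^bsub>T\<^esub> h \<boxplus>\<^bsub>T\<^esub> g \<boxtimes>\<^bsub>T\<^esub> h"
  proof (rule T_eqI)
    fix \<alpha> assume \<alpha>: "\<alpha> \<in> carrier G"
    have "((f \<boxplus>\<^bsub>T\<^esub> g) \<boxtimes>\<^bsub>T\<^esub> h) \<alpha> = ssum S (\<lambda>\<beta>. f \<beta> \<boxtimes> h (inv\<^bsub>G\<^esub> \<beta> \<otimes>\<^bsub>G\<^esub> \<alpha>)
        \<boxplus> g \<beta> \<boxtimes> h (inv\<^bsub>G\<^esub> \<beta> \<otimes>\<^bsub>G\<^esub> \<alpha>)) (carrier G)"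
      unfolding times_T [OF \<alpha>]
      by (intro ssum_cong) (simp_all add: plus_T distrib_right \<alpha> cl)
    then show "((f \<boxplus>\<^bsub>T\<^esub> g) \<boxtimes>\<^bsub>T\<^esub> h) \<alpha> = (f \<boxtimes>\<^bsub>T\<^esub> h \<boxplus>\<^bsub>T\<^esub> g \<boxtimes>\<^bsub>T\<^esub> h) \<alpha>"
      by (simp add: plus_T times_T ssum_plus \<alpha> cl)
  qed (simp_all add: plus_T_closed times_T_closed f g h)
  show "f \<boxtimes>\<^bsub>T\<^esub> (g \<boxplus>\<^bsub>T\<^esub> h) = f \<boxtimes>\<^bsub>T\<^esub> g \<boxplus>\<^bsub>T\<^esub> f \<boxtimes>\<^bsub>T\<^esub> h"
  proof (rule T_eqI)
    fix \<alpha> assume \<alpha>: "\<alpha> \<in> carrier G"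
    have "(f \<boxtimes>\<^bsub>T\<^esub> (g \<boxplus>\<^bsub>T\<^esub> h)) \<alpha> = ssum S (\<lambda>\<beta>. f \<beta> \<boxtimes> g (inv\<^bsub>G\<^esub> \<beta> \<otimes>\<^bsub>G\<^esub> \<alpha>)
        \<boxplus> f \<beta> \<boxtimes> h (inv\<^bsub>G\<^esub> \<beta> \<otimes>\<^bsub>G\<^esub> \<alpha>)) (carrier G)"
      unfolding times_T [OF \<alpha>]
      by (intro ssum_cong) (simp_all add: plus_T distrib_left \<alpha> cl)
    then show "(f \<boxtimes>\<^bsub>T\<^esub> (g \<boxplus>\<^bsub>T\<^esub> h)) \<alpha> = (f \<boxtimes>\<^bsub>T\<^esub> g \<boxplus>\<^bsub>T\<^esub> f \<boxtimes>\<^bsub>T\<^esub> h) \<alpha>"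
      by (simp add: plus_T times_T ssum_plus \<alpha> cl)
  qed (simp_all add: plus_T_closed times_T_closed f g h)
  show "(f \<boxtimes>\<^bsub>T\<^esub> g) \<boxtimes>\<^bsub>T\<^esub> h = f \<boxtimes>\<^bsub>T\<^esub> (g \<boxtimes>\<^bsub>T\<^esub> h)"
    using f g h by (rule times_T_assoc)
next
  fix f g assume f: "f \<in> carrier T" and g: "g \<in> carrier T"
  show "f \<boxplus>\<^bsub>T\<^esub> g \<in> carrier T" using f g by (rule plus_T_closed)
  show "f \<boxtimes>\<^bsub>T\<^esub> g \<in> carrier T" using f g by (rule times_T_closed)
  show "f \<boxplus>\<^bsub>T\<^esub> g = g \<boxplus>\<^bsub>T\<^esub> f"
    by (rule T_eqI) (simp_all add: plus_T plus_T_closed plus_commute T_apply f g)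
qed (rule local_identities_T)

lemma ssum_T:
  assumes "finite I" "I \<noteq> {}" "\<And>i. i \<in> I \<Longrightarrow> F i \<in> carrier T" "\<alpha> \<in> carrier G"
  shows "ssum T F I \<alpha> = ssum S (\<lambda>i. F i \<alpha>) I"
  using assms
proof (induction I rule: finite_ne_induct)
  case (singleton i)
  then show ?case by (simp add: ssum_singleton T_apply)
next
  case (insert i I)
  interpret T: local_semiring T by (rule local_semiring_T)
  show ?case using insert by (simp add: ssum_insert' T.ssum_insert' plus_T T_apply)
qed

text \<open>Entries of matrix products over the group semiring, as single sums in \<open>S\<close> over pairs.\<close>

lemma ssum_times_T:
  assumes I: "finite I" "I \<noteq> {}" and f: "\<And>i. i \<in> I \<Longrightarrow> f i \<in> carrier T"
    and g: "\<And>i. i \<in> I \<Longrightarrow> g i \<in> carrier T" and \<alpha>: "\<alpha> \<in> carrier G"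
  shows "ssum T (\<lambda>i. f i \<boxtimes>\<^bsub>T\<^esub> g i) I \<alpha>
    = ssum S (\<lambda>(i, \<beta>). f i \<beta> \<boxtimes> g i (inv\<^bsub>G\<^esub> \<beta> \<otimes>\<^bsub>G\<^esub> \<alpha>)) (I \<times> carrier G)"
  using assms finite_group group_nonempty
  by (simp add: ssum_T times_T_closed times_T ssum_Times T_apply times_closed)

lemma ssum_times_T':
  assumes I: "finite I" "I \<noteq> {}" and f: "\<And>i. i \<in> I \<Longrightarrow> f i \<in> carrier T"
    and g: "\<And>i. i \<in> I \<Longrightarrow> g i \<in> carrier T" and \<alpha>: "\<alpha> \<in> carrier G"
  shows "ssum T (\<lambda>i. f i \<boxtimes>\<^bsub>T\<^esub> g i) I \<alpha>
    = ssum S (\<lambda>(i, \<gamma>). f i (\<alpha> \<otimes>\<^bsub>G\<^esub> inv\<^bsub>G\<^esub> \<gamma>) \<boxtimes> g i \<gamma>) (I \<times> carrier G)"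
proof -
  have "ssum T (\<lambda>i. f i \<boxtimes>\<^bsub>T\<^esub> g i) I \<alpha> = ssum S (\<lambda>i. (f i \<boxtimes>\<^bsub>T\<^esub> g i) \<alpha>) I"
    using assms by (intro ssum_T times_T_closed)
  also have "\<dots> = ssum S (\<lambda>i. ssum S (\<lambda>\<gamma>. f i (\<alpha> \<otimes>\<^bsub>G\<^esub> inv\<^bsub>G\<^esub> \<gamma>) \<boxtimes> g i \<gamma>) (carrier G)) I"
    using assms finite_group group_nonempty
    by (intro ssum_cong) (simp_all add: times_T' ssum_closed T_apply times_closed)
  also have "\<dots> = ssum S (\<lambda>(i, \<gamma>). f i (\<alpha> \<otimes>\<^bsub>G\<^esub> inv\<^bsub>G\<^esub> \<gamma>) \<boxtimes> g i \<gamma>) (I \<times> carrier G)"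
    using assms finite_group group_nonempty
    by (subst ssum_Times) (simp_all add: T_apply times_closed)
  finally show ?thesis .
qed

text \<open>A vector over \<open>S\<close> indexed by pairs, turned into a vector over the group semiring; the group
  index is inverted.\<close>

definition reflect :: "('i \<times> 'g \<Rightarrow> 'a) \<Rightarrow> 'i \<Rightarrow> 'g \<Rightarrow> 'a" where
  "reflect w i = (\<lambda>\<alpha>\<in>carrier G. w (i, inv\<^bsub>G\<^esub> \<alpha>))"

lemma reflect_closed:
  "\<lbrakk>w \<in> I \<times> carrier G \<rightarrow> carrier S; i \<in> I\<rbrakk> \<Longrightarrow> reflect w i \<in> carrier T"
  by (auto simp: reflect_def carrier_T)

text \<open>Substituting \<open>\<gamma> = \<beta> \<alpha>\<close> in the convolution cancels the inversion. If \<open>a\<close> is a row of the matrix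
  \<open>A\<close>, then the coefficients \<open>a j (\<beta> \<alpha>)\<close> form the row of the expanded matrix with group index
  \<open>\<beta>\<inverse>\<close>; for \<open>\<beta> = \<one>\<close> they are the values of \<open>a\<close> itself. In the second lemma \<open>a\<close> is a column, and
  the coefficients \<open>a i (\<beta> \<alpha>)\<close> form the column with group index \<open>\<alpha>\<inverse>\<close> of the matrix expanded for
  columns.\<close>

lemma ssum_times_T_reflect_right:
  assumes J: "finite J" "J \<noteq> {}" and a: "\<And>j. j \<in> J \<Longrightarrow> a j \<in> carrier T"
    and w: "w \<in> J \<times> carrier G \<rightarrow> carrier S" and \<beta>: "\<beta> \<in> carrier G"
  shows "ssum T (\<lambda>j. a j \<boxtimes>\<^bsub>T\<^esub> reflect w j) J \<beta>
    = ssum S (\<lambda>(j, \<alpha>). a j (\<beta> \<otimes>\<^bsub>G\<^esub> \<alpha>) \<boxtimes> w (j, \<alpha>)) (J \<times> carrier G)"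
proof -
  let ?t = "\<lambda>(j, \<gamma>). a j \<gamma> \<boxtimes> reflect w j (inv\<^bsub>G\<^esub> \<gamma> \<otimes>\<^bsub>G\<^esub> \<beta>)"
  have W: "reflect w j \<in> carrier T" if "j \<in> J" for j
    using w that by (rule reflect_closed)
  have "ssum T (\<lambda>j. a j \<boxtimes>\<^bsub>T\<^esub> reflect w j) J \<beta> = ssum S ?t (J \<times> carrier G)"
    by (rule ssum_times_T [OF J a W \<beta>])
  also have "\<dots> = ssum S (\<lambda>p. ?t (map_prod id (\<lambda>\<alpha>. \<beta> \<otimes>\<^bsub>G\<^esub> \<alpha>) p)) (J \<times> carrier G)"
    by (intro ssum_reindex_bij_betw [symmetric] bij_betw_map_prod bij_betw_mult_left)
      (use J \<beta> w finite_group group_nonempty in \<open>auto simp: reflect_def intro!: times_closed T_apply [OF a]\<close>)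
  also have "\<dots> = ssum S (\<lambda>(j, \<alpha>). a j (\<beta> \<otimes>\<^bsub>G\<^esub> \<alpha>) \<boxtimes> w (j, \<alpha>)) (J \<times> carrier G)"
  proof (rule ssum_cong)
    fix p assume "p \<in> J \<times> carrier G"
    then obtain j \<alpha> where p: "p = (j, \<alpha>)" "j \<in> J" "\<alpha> \<in> carrier G" by auto
    have "inv\<^bsub>G\<^esub> (inv\<^bsub>G\<^esub> (\<beta> \<otimes>\<^bsub>G\<^esub> \<alpha>) \<otimes>\<^bsub>G\<^esub> \<beta>) = \<alpha>"
      using p \<beta> by (simp add: inv_mult_group m_assoc)
    then show "?t (map_prod id (\<lambda>\<alpha>. \<beta> \<otimes>\<^bsub>G\<^esub> \<alpha>) p)
        = (case p of (j, \<alpha>) \<Rightarrow> a j (\<beta> \<otimes>\<^bsub>G\<^esub> \<alpha>) \<boxtimes> w (j, \<alpha>))"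
      using p \<beta> by (simp add: reflect_def)
  qed (use J \<beta> w finite_group group_nonempty in \<open>auto intro!: times_closed T_apply [OF a]\<close>)
  finally show ?thesis .
qed

lemma ssum_times_T_reflect_left:
  assumes I: "finite I" "I \<noteq> {}" and a: "\<And>i. i \<in> I \<Longrightarrow> a i \<in> carrier T"
    and w: "w \<in> I \<times> carrier G \<rightarrow> carrier S" and \<alpha>: "\<alpha> \<in> carrier G"
  shows "ssum T (\<lambda>i. reflect w i \<boxtimes>\<^bsub>T\<^esub> a i) I \<alpha>
    = ssum S (\<lambda>(i, \<beta>). w (i, \<beta>) \<boxtimes> a i (\<beta> \<otimes>\<^bsub>G\<^esub> \<alpha>)) (I \<times> carrier G)"
proof -
  let ?t = "\<lambda>(i, \<gamma>). reflect w i (\<alpha> \<otimes>\<^bsub>G\<^esub> inv\<^bsub>G\<^esub> \<gamma>) \<boxtimes> a i \<gamma>"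
  have W: "reflect w i \<in> carrier T" if "i \<in> I" for i
    using w that by (rule reflect_closed)
  have "ssum T (\<lambda>i. reflect w i \<boxtimes>\<^bsub>T\<^esub> a i) I \<alpha> = ssum S ?t (I \<times> carrier G)"
    by (rule ssum_times_T' [OF I W a \<alpha>])
  also have "\<dots> = ssum S (\<lambda>p. ?t (map_prod id (\<lambda>\<beta>. \<beta> \<otimes>\<^bsub>G\<^esub> \<alpha>) p)) (I \<times> carrier G)"
    by (intro ssum_reindex_bij_betw [symmetric] bij_betw_map_prod bij_betw_mult_right)
      (use I \<alpha> w finite_group group_nonempty in \<open>auto simp: reflect_def intro!: times_closed T_apply [OF a]\<close>)
  also have "\<dots> = ssum S (\<lambda>(i, \<beta>). w (i, \<beta>) \<boxtimes> a i (\<beta> \<otimes>\<^bsub>G\<^esub> \<alpha>)) (I \<times> carrier G)"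
  proof (rule ssum_cong)
    fix p assume "p \<in> I \<times> carrier G"
    then obtain i \<beta> where p: "p = (i, \<beta>)" "i \<in> I" "\<beta> \<in> carrier G" by auto
    have "inv\<^bsub>G\<^esub> (\<alpha> \<otimes>\<^bsub>G\<^esub> inv\<^bsub>G\<^esub> (\<beta> \<otimes>\<^bsub>G\<^esub> \<alpha>)) = \<beta>"
      using p \<alpha> by (simp add: inv_mult_group m_assoc)
    then show "?t (map_prod id (\<lambda>\<beta>. \<beta> \<otimes>\<^bsub>G\<^esub> \<alpha>) p)
        = (case p of (i, \<beta>) \<Rightarrow> w (i, \<beta>) \<boxtimes> a i (\<beta> \<otimes>\<^bsub>G\<^esub> \<alpha>))"
      using p \<alpha> by (simp add: reflect_def)
  qed (use I \<alpha> w finite_group group_nonempty in \<open>auto intro!: times_closed T_apply [OF a]\<close>)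
  finally show ?thesis .
qed

end

section \<open>Exactness of the group semiring\<close>

locale exact_semiring_finite_group = exact_semiring S + semiring_finite_group S G
  for S :: "('a, 'm) add_mult_scheme" (structure) and G :: "('g, 'k) monoid_scheme"
begin

lemma row_separated_T:
  assumes I: "finite I" "I \<noteq> {}" and J: "finite J" "J \<noteq> {}"
    and A: "\<And>i j. i \<in> I \<Longrightarrow> j \<in> J \<Longrightarrow> A i j \<in> carrier T"
    and x: "\<And>j. j \<in> J \<Longrightarrow> x j \<in> carrier T"
    and not_span: "\<not> in_row_span T I J A x"
  shows "row_separated T I J A x"
proof -
  interpret T: local_semiring T by (rule local_semiring_T)
  note fin = I J finite_group group_nonempty
  \<comment> \<open>The expanded matrix for products with a row vector: \<open>u B\<close> corresponds to \<open>u A\<close>.\<close>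
  define B where "B p q = A (fst p) (fst q) (inv\<^bsub>G\<^esub> (snd p) \<otimes>\<^bsub>G\<^esub> snd q)" for p q :: "_ \<times> 'g"
  define X where "X q = x (fst q) (snd q)" for q
  have "\<not> in_row_span S (I \<times> carrier G) (J \<times> carrier G) B X"
  proof
    assume "in_row_span S (I \<times> carrier G) (J \<times> carrier G) B X"
    then obtain w where w: "w \<in> I \<times> carrier G \<rightarrow> carrier S"
      and wB: "\<And>q. q \<in> J \<times> carrier G \<Longrightarrow> ssum S (\<lambda>p. w p \<boxtimes> B p q) (I \<times> carrier G) = X q"
      by (auto simp: in_row_span_def)
    define u where "u i = (\<lambda>\<beta>\<in>carrier G. w (i, \<beta>))" for i
    have u: "u i \<in> carrier T" if "i \<in> I" for i
      using w that by (auto simp: u_def carrier_T)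
    have "ssum T (\<lambda>i. u i \<boxtimes>\<^bsub>T\<^esub> A i j) I = x j" if j: "j \<in> J" for j
    proof (rule T_eqI)
      fix \<alpha> assume \<alpha>: "\<alpha> \<in> carrier G"
      have "ssum T (\<lambda>i. u i \<boxtimes>\<^bsub>T\<^esub> A i j) I \<alpha>
          = ssum S (\<lambda>(i, \<beta>). u i \<beta> \<boxtimes> A i j (inv\<^bsub>G\<^esub> \<beta> \<otimes>\<^bsub>G\<^esub> \<alpha>)) (I \<times> carrier G)"
        using I u A j \<alpha> by (intro ssum_times_T) auto
      also have "\<dots> = ssum S (\<lambda>p. w p \<boxtimes> B p (j, \<alpha>)) (I \<times> carrier G)"
        using fin w A j \<alpha>
        by (intro ssum_cong) (auto simp: u_def B_def intro!: times_closed T_apply [OF A])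
      finally show "ssum T (\<lambda>i. u i \<boxtimes>\<^bsub>T\<^esub> A i j) I \<alpha> = x j \<alpha>"
        using wB j \<alpha> by (simp add: X_def)
    qed (use I u A x j in \<open>auto intro!: T.ssum_closed T.times_closed\<close>)
    then show False using not_span u by (auto simp: in_row_span_def)
  qed
  then have "row_separated S (I \<times> carrier G) (J \<times> carrier G) B X"
    using fin A x by (intro row_separated_family) (auto simp: B_def X_def intro!: T_apply [OF A] T_apply [OF x])
  then obtain v v' where v: "v \<in> J \<times> carrier G \<rightarrow> carrier S" "v' \<in> J \<times> carrier G \<rightarrow> carrier S"
    and Bv: "\<And>p. p \<in> I \<times> carrier G \<Longrightarrow>
      ssum S (\<lambda>q. B p q \<boxtimes> v q) (J \<times> carrier G) = ssum S (\<lambda>q. B p q \<boxtimes> v' q) (J \<times> carrier G)"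
    and Xv: "ssum S (\<lambda>q. X q \<boxtimes> v q) (J \<times> carrier G) \<noteq> ssum S (\<lambda>q. X q \<boxtimes> v' q) (J \<times> carrier G)"
    by (auto simp: row_separated_def)
  have AW: "ssum T (\<lambda>j. A i j \<boxtimes>\<^bsub>T\<^esub> reflect w j) J \<beta>
      = ssum S (\<lambda>q. B (i, inv\<^bsub>G\<^esub> \<beta>) q \<boxtimes> w q) (J \<times> carrier G)"
    if "w \<in> J \<times> carrier G \<rightarrow> carrier S" "i \<in> I" "\<beta> \<in> carrier G" for w i \<beta>
    using that by (subst ssum_times_T_reflect_right [OF J A]) (simp_all add: B_def case_prod_unfold)
  have xW: "ssum T (\<lambda>j. x j \<boxtimes>\<^bsub>T\<^esub> reflect w j) J \<one>\<^bsub>G\<^esub> = ssum S (\<lambda>q. X q \<boxtimes> w q) (J \<times> carrier G)"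
    if w: "w \<in> J \<times> carrier G \<rightarrow> carrier S" for w
  proof -
    have "ssum T (\<lambda>j. x j \<boxtimes>\<^bsub>T\<^esub> reflect w j) J \<one>\<^bsub>G\<^esub>
        = ssum S (\<lambda>(j, \<alpha>). x j (\<one>\<^bsub>G\<^esub> \<otimes>\<^bsub>G\<^esub> \<alpha>) \<boxtimes> w (j, \<alpha>)) (J \<times> carrier G)"
      using J x w by (intro ssum_times_T_reflect_right) auto
    also have "\<dots> = ssum S (\<lambda>q. X q \<boxtimes> w q) (J \<times> carrier G)"
      using fin x w by (intro ssum_cong) (auto simp: X_def intro!: times_closed T_apply [OF x])
    finally show ?thesis .
  qed
  have "ssum T (\<lambda>j. A i j \<boxtimes>\<^bsub>T\<^esub> reflect v j) J = ssum T (\<lambda>j. A i j \<boxtimes>\<^bsub>T\<^esub> reflect v' j) J" if i: "i \<in> I" for i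
  proof (rule T_eqI)
    fix \<beta> assume \<beta>: "\<beta> \<in> carrier G"
    show "ssum T (\<lambda>j. A i j \<boxtimes>\<^bsub>T\<^esub> reflect v j) J \<beta> = ssum T (\<lambda>j. A i j \<boxtimes>\<^bsub>T\<^esub> reflect v' j) J \<beta>"
      unfolding AW [OF v(1) i \<beta>] AW [OF v(2) i \<beta>] using i \<beta> by (intro Bv) simp
  qed (intro T.ssum_closed J T.times_closed A i reflect_closed [OF v(1)] reflect_closed [OF v(2)];
      assumption)+
  moreover have "ssum T (\<lambda>j. x j \<boxtimes>\<^bsub>T\<^esub> reflect v j) J \<noteq> ssum T (\<lambda>j. x j \<boxtimes>\<^bsub>T\<^esub> reflect v' j) J"
    using Xv by (auto simp: xW [OF v(1), symmetric] xW [OF v(2), symmetric])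
  ultimately show ?thesis
    unfolding row_separated_def
    by (intro bexI [of _ "reflect v"] bexI [of _ "reflect v'"] conjI ballI)
      (simp_all add: reflect_closed [OF v(1)] reflect_closed [OF v(2)])
qed

lemma col_separated_T:
  assumes I: "finite I" "I \<noteq> {}" and J: "finite J" "J \<noteq> {}"
    and A: "\<And>i j. i \<in> I \<Longrightarrow> j \<in> J \<Longrightarrow> A i j \<in> carrier T"
    and y: "\<And>i. i \<in> I \<Longrightarrow> y i \<in> carrier T"
    and not_span: "\<not> in_col_span T I J A y"
  shows "col_separated T I J A y"
proof -
  interpret T: local_semiring T by (rule local_semiring_T)
  note fin = I J finite_group group_nonempty
  \<comment> \<open>The expanded matrix for products with a column vector: \<open>B v\<close> corresponds to \<open>A v\<close>.\<close>
  define B where "B p q = A (fst p) (fst q) (snd p \<otimes>\<^bsub>G\<^esub> inv\<^bsub>G\<^esub> (snd q))" for p q :: "_ \<times> 'g"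
  define Y where "Y p = y (fst p) (snd p)" for p
  have "\<not> in_col_span S (I \<times> carrier G) (J \<times> carrier G) B Y"
  proof
    assume "in_col_span S (I \<times> carrier G) (J \<times> carrier G) B Y"
    then obtain w where w: "w \<in> J \<times> carrier G \<rightarrow> carrier S"
      and Bw: "\<And>p. p \<in> I \<times> carrier G \<Longrightarrow> ssum S (\<lambda>q. B p q \<boxtimes> w q) (J \<times> carrier G) = Y p"
      by (auto simp: in_col_span_def)
    define v where "v j = (\<lambda>\<gamma>\<in>carrier G. w (j, \<gamma>))" for j
    have v: "v j \<in> carrier T" if "j \<in> J" for j
      using w that by (auto simp: v_def carrier_T)
    have "ssum T (\<lambda>j. A i j \<boxtimes>\<^bsub>T\<^esub> v j) J = y i" if i: "i \<in> I" for i
    proof (rule T_eqI)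
      fix \<beta> assume \<beta>: "\<beta> \<in> carrier G"
      have "ssum T (\<lambda>j. A i j \<boxtimes>\<^bsub>T\<^esub> v j) J \<beta>
          = ssum S (\<lambda>(j, \<gamma>). A i j (\<beta> \<otimes>\<^bsub>G\<^esub> inv\<^bsub>G\<^esub> \<gamma>) \<boxtimes> v j \<gamma>) (J \<times> carrier G)"
        using J v A i \<beta> by (intro ssum_times_T') auto
      also have "\<dots> = ssum S (\<lambda>q. B (i, \<beta>) q \<boxtimes> w q) (J \<times> carrier G)"
        using fin w A i \<beta>
        by (intro ssum_cong) (auto simp: v_def B_def intro!: times_closed T_apply [OF A])
      finally show "ssum T (\<lambda>j. A i j \<boxtimes>\<^bsub>T\<^esub> v j) J \<beta> = y i \<beta>"
        using Bw i \<beta> by (simp add: Y_def)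
    qed (use J v A y i in \<open>auto intro!: T.ssum_closed T.times_closed\<close>)
    then show False using not_span v by (auto simp: in_col_span_def)
  qed
  then have "col_separated S (I \<times> carrier G) (J \<times> carrier G) B Y"
    using fin A y by (intro col_separated_family) (auto simp: B_def Y_def intro!: T_apply [OF A] T_apply [OF y])
  then obtain u u' where u: "u \<in> I \<times> carrier G \<rightarrow> carrier S" "u' \<in> I \<times> carrier G \<rightarrow> carrier S"
    and uB: "\<And>q. q \<in> J \<times> carrier G \<Longrightarrow>
      ssum S (\<lambda>p. u p \<boxtimes> B p q) (I \<times> carrier G) = ssum S (\<lambda>p. u' p \<boxtimes> B p q) (I \<times> carrier G)"
    and uY: "ssum S (\<lambda>p. u p \<boxtimes> Y p) (I \<times> carrier G) \<noteq> ssum S (\<lambda>p. u' p \<boxtimes> Y p) (I \<times> carrier G)"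
    by (auto simp: col_separated_def)
  have WA: "ssum T (\<lambda>i. reflect w i \<boxtimes>\<^bsub>T\<^esub> A i j) I \<alpha>
      = ssum S (\<lambda>p. w p \<boxtimes> B p (j, inv\<^bsub>G\<^esub> \<alpha>)) (I \<times> carrier G)"
    if "w \<in> I \<times> carrier G \<rightarrow> carrier S" "j \<in> J" "\<alpha> \<in> carrier G" for w j \<alpha>
    using that by (subst ssum_times_T_reflect_left [OF I A]) (simp_all add: B_def case_prod_unfold)
  have Wy: "ssum T (\<lambda>i. reflect w i \<boxtimes>\<^bsub>T\<^esub> y i) I \<one>\<^bsub>G\<^esub> = ssum S (\<lambda>p. w p \<boxtimes> Y p) (I \<times> carrier G)"
    if w: "w \<in> I \<times> carrier G \<rightarrow> carrier S" for w
  proof -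
    have "ssum T (\<lambda>i. reflect w i \<boxtimes>\<^bsub>T\<^esub> y i) I \<one>\<^bsub>G\<^esub>
        = ssum S (\<lambda>(i, \<beta>). w (i, \<beta>) \<boxtimes> y i (\<beta> \<otimes>\<^bsub>G\<^esub> \<one>\<^bsub>G\<^esub>)) (I \<times> carrier G)"
      using I y w by (intro ssum_times_T_reflect_left) auto
    also have "\<dots> = ssum S (\<lambda>p. w p \<boxtimes> Y p) (I \<times> carrier G)"
      using fin y w by (intro ssum_cong) (auto simp: Y_def intro!: times_closed T_apply [OF y])
    finally show ?thesis .
  qed
  have "ssum T (\<lambda>i. reflect u i \<boxtimes>\<^bsub>T\<^esub> A i j) I = ssum T (\<lambda>i. reflect u' i \<boxtimes>\<^bsub>T\<^esub> A i j) I" if j: "j \<in> J" for j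
  proof (rule T_eqI)
    fix \<alpha> assume \<alpha>: "\<alpha> \<in> carrier G"
    show "ssum T (\<lambda>i. reflect u i \<boxtimes>\<^bsub>T\<^esub> A i j) I \<alpha> = ssum T (\<lambda>i. reflect u' i \<boxtimes>\<^bsub>T\<^esub> A i j) I \<alpha>"
      unfolding WA [OF u(1) j \<alpha>] WA [OF u(2) j \<alpha>] using j \<alpha> by (intro uB) simp
  qed (intro T.ssum_closed I T.times_closed A j reflect_closed [OF u(1)] reflect_closed [OF u(2)];
      assumption)+
  moreover have "ssum T (\<lambda>i. reflect u i \<boxtimes>\<^bsub>T\<^esub> y i) I \<noteq> ssum T (\<lambda>i. reflect u' i \<boxtimes>\<^bsub>T\<^esub> y i) I"
    using uY by (auto simp: Wy [OF u(1), symmetric] Wy [OF u(2), symmetric])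
  ultimately show ?thesis
    unfolding col_separated_def
    by (intro bexI [of _ "reflect u"] bexI [of _ "reflect u'"] conjI ballI)
      (simp_all add: reflect_closed [OF u(1)] reflect_closed [OF u(2)])
qed

end

theorem theorem5p3:
  fixes S :: "('a, 'm) add_mult_scheme" and \<Gamma> :: "('g, 'k) monoid_scheme"
  assumes "exact_semiring S" and "group \<Gamma>" and "finite (carrier \<Gamma>)"
  shows "exact_semiring (group_semiring S \<Gamma>)"
proof -
  interpret S: exact_semiring S by (rule assms)
  interpret \<Gamma>: group \<Gamma> by (rule assms)
  interpret exact_semiring_finite_group S \<Gamma> by unfold_locales (rule assms)
  interpret S\<Gamma>: local_semiring "group_semiring S \<Gamma>" by (rule local_semiring_T)
  show ?thesis
  proof (rule S\<Gamma>.exact_semiringI)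
    fix m n :: nat and A x
    assume "0 < m" "0 < n" "\<And>i j. i < m \<Longrightarrow> j < n \<Longrightarrow> A i j \<in> carrier (group_semiring S \<Gamma>)"
      "\<And>j. j < n \<Longrightarrow> x j \<in> carrier (group_semiring S \<Gamma>)"
      "\<not> in_row_span (group_semiring S \<Gamma>) {..<m} {..<n} A x"
    then show "row_separated (group_semiring S \<Gamma>) {..<m} {..<n} A x"
      by (intro row_separated_T) auto
  next
    fix m n :: nat and A y
    assume "0 < m" "0 < n" "\<And>i j. i < m \<Longrightarrow> j < n \<Longrightarrow> A i j \<in> carrier (group_semiring S \<Gamma>)"
      "\<And>i. i < m \<Longrightarrow> y i \<in> carrier (group_semiring S \<Gamma>)"
      "\<not> in_col_span (group_semiring S \<Gamma>) {..<m} {..<n} A y"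
    then show "col_separated (group_semiring S \<Gamma>) {..<m} {..<n} A y"
      by (intro col_separated_T) auto
  qed
qed

end
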